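(* Let $d\geq 2$. Then the Bloch variety $B(V)\subset\mathbb{C}^{d+1}$ is irreducible modulo periodicity: for any two irreducible components $\Omega_1,\Omega_2$ of $B(V)$ there exists $k\in\mathbb{Z}^d$ with $\Omega_1=(k,0)+\Omega_2$.
   Context: Fix positive integers $q_1,\dots,q_d$ with greatest common divisor $1$, $\Gamma=q_1\mathbb{Z}\oplus\cdots\oplus q_d\mathbb{Z}$, and a $\Gamma$-periodic $V:\mathbb{Z}^d\to\mathbb{C}$ (possibly complex-valued). The discrete Laplacian is $(\Delta u)(n)=\sum_{\|n'-n\|_1=1}u(n')$, $e_j$ the standard basis vectors. The Bloch variety $B(V)$ is the set of $(k,\lambda)\in\mathbb{C}^{d+1}$ for which there exists a nonzero $u:\mathbb{Z}^d\to\mathbb{C}$ with $-\Delta u+Vu=\lambda u$ on $\mathbb{Z}^d$ and $u(n+q_je_j)=e^{2\pi i k_j}u(n)$ for all $j$ and $n$; it is an analytic subset of $\mathbb{C}^{d+1}$. An analytic set is irreducible if it is not the union of two nonempty proper analytic subsets. *)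

theory Defs
  imports "HOL-Analysis.Analysis"
begin

text \<open>Points of C^(d+1) are pairs (k, lambda) with k :: complex^'n, lambda :: complex,
  where d = CARD('n).\<close>

definition cscale :: "complex \<Rightarrow> (complex^'n) \<times> complex \<Rightarrow> (complex^'n) \<times> complex" where
  "cscale c z = ((\<chi> i. c * (fst z) $ i), c * snd z)"

definition holo_on :: "((complex^'n) \<times> complex \<Rightarrow> complex) \<Rightarrow> ((complex^'n) \<times> complex) set \<Rightarrow> bool" where
  "holo_on f U \<longleftrightarrow> (\<forall>z\<in>U. \<exists>L. (f has_derivative L) (at z) \<and> (\<forall>c w. L (cscale c w) = c * L w))"

definition analytic_set :: "((complex^'n) \<times> complex) set \<Rightarrow> bool" where
  "analytic_set A \<longleftrightarrow> (\<forall>z. \<exists>U F. open U \<and> z \<in> U \<and> finite F \<and> (\<forall>f\<in>F. holo_on f U) \<and>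
       A \<inter> U = {w\<in>U. \<forall>f\<in>F. f w = 0})"

definition irreducible_analytic :: "((complex^'n) \<times> complex) set \<Rightarrow> bool" where
  "irreducible_analytic A \<longleftrightarrow> analytic_set A \<and> A \<noteq> {} \<and>
     \<not> (\<exists>A1 A2. analytic_set A1 \<and> analytic_set A2 \<and> A1 \<noteq> {} \<and> A2 \<noteq> {} \<and>
            A1 \<subset> A \<and> A2 \<subset> A \<and> A = A1 \<union> A2)"

definition irreducible_component :: "((complex^'n) \<times> complex) set \<Rightarrow> ((complex^'n) \<times> complex) set \<Rightarrow> bool" where
  "irreducible_component A B \<longleftrightarrow> B \<subseteq> A \<and> irreducible_analytic B \<and>
     (\<forall>C. irreducible_analytic C \<and> B \<subseteq> C \<and> C \<subseteq> A \<longrightarrow> C = B)"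

definition dlap :: "(int^'n \<Rightarrow> complex) \<Rightarrow> int^'n \<Rightarrow> complex" where
  "dlap u n = (\<Sum>j\<in>UNIV. u (n + axis j 1) + u (n - axis j 1))"

definition bloch_variety :: "int^'n \<Rightarrow> (int^'n \<Rightarrow> complex) \<Rightarrow> ((complex^'n) \<times> complex) set" where
  "bloch_variety q V = {(k, lam). \<exists>u. u \<noteq> (\<lambda>_. 0) \<and>
      (\<forall>n. - dlap u n + V n * u n = lam * u n) \<and>
      (\<forall>j n. u (n + axis j (q $ j)) = exp (2 * pi * \<i> * k $ j) * u n)}"

end

theory Submission
  imports Defs "HOL-Complex_Analysis.Complex_Analysis" "HOL-Computational_Algebra.Field_as_Ring"
    "Subresultants.Subresultant_Gcd" "Jordan_Normal_Form.Char_Poly"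
begin

text \<open>
  After a gauge transformation, \<open>(k, \<lambda>)\<close> lies on the Bloch variety iff \<open>\<lambda>\<close> is an eigenvalue of a finite
  matrix depending entirely on \<open>k\<close>, so the variety is the zero set of a monic polynomial in \<open>\<lambda>\<close> with
  entire coefficients. Where the discriminant does not vanish the variety is a finite covering of a
  connected dense open set. The closure of a connected component \<open>T\<close> of this covering is analytic: the
  product of \<open>\<lambda> - \<lambda>'\<close> over the sheets of \<open>T\<close> is locally bounded and extends by Riemann's theorem. It is
  irreducible by the identity theorem, and the irreducible components are exactly these closures.

  It remains to see that the integer translations permute the connected components transitively. For
  \<open>Im k\<^sub>j\<close> very negative at lacunary rates in \<open>j\<close>, the forward hops dominate, and the eigenvalues over
  \<open>k* + x\<close> (\<open>x\<close> real) are close to a multiple of \<open>a (x + m)\<close>, where \<open>m\<close> ranges over the period cell and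
  \<open>a x = - (\<Sum>j. c\<^sub>j e\<^bsup>2\<pi>\<i> x\<^sub>j / q\<^sub>j\<^esup>)\<close>; lacunarity of the \<open>c\<^sub>j\<close> keeps them apart uniformly in \<open>x\<close>. The
  eigenvalue near \<open>a x\<close> is thus a continuous function of \<open>x \<in> \<real>\<^sup>d\<close> whose values at \<open>x + m\<close> give all
  eigenvalues over \<open>k* + x\<close>, so each sheet is moved to any other by translation and continuation.
\<close>

text \<open>One asymptotic regime has to supply three things: a parameter with simple eigenvalues,
  without which the discriminant could vanish identically and the covering be empty; a connected set
  of parameters over which one eigenvalue can be followed without collision; and a link between that
  eigenvalue and all the others. Real translations of \<open>k\<close> give the connected set, since
  they rotate the hopping weights and keep their moduli. Integer points give the link: periodicity
  carries the eigenvalue over \<open>kst + m\<close> back to \<open>kst\<close>, where it sits at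
  the centre numbered by \<open>m\<close>. So no monodromy has to be computed.

  The growth of the \<open>c j\<close> is explicit rather than generic because separation is wanted
  for all rotations at once: a difference of two centres is a sum of \<open>c j\<close> times
  differences of roots of unity, up to unimodular factors, and the term with the largest weight
  dominates it. To reach the regime, the matrix is multiplied by a small \<epsilon> and the
  imaginary parts of \<open>kst\<close> are tuned so that the forward weights stay equal to
  \<open>c j\<close> in modulus. The limit \<epsilon> = 0 is then an honest operator, and the
  rotations range over a compact torus.\<close>

no_notation vec_index (infixl "$" 100)
no_notation fps_nth (infixl "$" 75)

section \<open>Holomorphic functions of several variables\<close>

lemma cscale_add_left: "cscale (a + b) w = cscale a w + cscale b w"
  by (simp add: cscale_def prod_eq_iff Finite_Cartesian_Product.vec_eq_iff algebra_simps)

lemma cscale_scaleR: "cscale (r *\<^sub>R c) w = r *\<^sub>R cscale c w"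
  by (simp add: cscale_def prod_eq_iff Finite_Cartesian_Product.vec_eq_iff)

lemma cscale_0 [simp]: "cscale 0 w = 0" and cscale_1 [simp]: "cscale 1 w = w"
  by (simp_all add: cscale_def prod_eq_iff Finite_Cartesian_Product.vec_eq_iff)

lemma norm_cscale: "norm (cscale c w) = norm c * norm w"
proof -
  have "norm (cscale c w) ^ 2 = (norm c * norm w) ^ 2"
    by (simp add: cscale_def norm_prod_def norm_vec_def L2_set_def sum_nonneg power_mult_distrib
        norm_mult sum_distrib_left algebra_simps)
  thus ?thesis by (simp add: power2_eq_iff_nonneg)
qed

lemma bounded_linear_cscale_left: "bounded_linear (\<lambda>c. cscale c w)"
  by (rule bounded_linear_intro[where K = "norm w"])
    (simp_all add: cscale_add_left cscale_scaleR norm_cscale)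

lemma continuous_on_cscale [continuous_intros]:
  assumes "continuous_on S a" "continuous_on S b"
  shows "continuous_on S (\<lambda>x. cscale (a x) (b x))"
  unfolding cscale_def by (intro continuous_intros assms)

lemma holo_on_subset: "holo_on f U \<Longrightarrow> W \<subseteq> U \<Longrightarrow> holo_on f W"
  unfolding holo_on_def by blast

lemma holo_on_imp_continuous_on: "holo_on f U \<Longrightarrow> continuous_on U f"
  unfolding holo_on_def
  by (meson continuous_at_imp_continuous_on has_derivative_continuous)

lemma holo_on_const: "holo_on (\<lambda>_. c) U"
  unfolding holo_on_def by (intro ballI exI[of _ "\<lambda>_. 0"]) auto

lemma holo_on_snd: "holo_on snd U"
  unfolding holo_on_def
  by (intro ballI exI[of _ snd]) (auto intro!: derivative_eq_intros simp: cscale_def)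

lemma holo_on_fst_nth: "holo_on (\<lambda>z. fst z $ i) U"
  unfolding holo_on_def
  by (intro ballI exI[of _ "\<lambda>z. fst z $ i"])
    (auto intro!: bounded_linear_imp_has_derivative bounded_linear_compose[OF bounded_linear_vec_nth bounded_linear_fst] simp: cscale_def)

lemma holo_on_add: "holo_on f U \<Longrightarrow> holo_on g U \<Longrightarrow> holo_on (\<lambda>z. f z + g z) U"
  unfolding holo_on_def
proof
  fix z assume *: "\<forall>z\<in>U. \<exists>L. (f has_derivative L) (at z) \<and> (\<forall>c w. L (cscale c w) = c * L w)"
    "\<forall>z\<in>U. \<exists>L. (g has_derivative L) (at z) \<and> (\<forall>c w. L (cscale c w) = c * L w)" "z \<in> U"
  then obtain L M where "(f has_derivative L) (at z)" "\<forall>c w. L (cscale c w) = c * L w"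
    "(g has_derivative M) (at z)" "\<forall>c w. M (cscale c w) = c * M w" by blast
  thus "\<exists>L. ((\<lambda>z. f z + g z) has_derivative L) (at z) \<and> (\<forall>c w. L (cscale c w) = c * L w)"
    by (intro exI[of _ "\<lambda>w. L w + M w"]) (auto intro!: derivative_eq_intros simp: algebra_simps)
qed

lemma holo_on_mult: "holo_on f U \<Longrightarrow> holo_on g U \<Longrightarrow> holo_on (\<lambda>z. f z * g z) U"
  unfolding holo_on_def
proof
  fix z assume *: "\<forall>z\<in>U. \<exists>L. (f has_derivative L) (at z) \<and> (\<forall>c w. L (cscale c w) = c * L w)"
    "\<forall>z\<in>U. \<exists>L. (g has_derivative L) (at z) \<and> (\<forall>c w. L (cscale c w) = c * L w)" "z \<in> U"
  then obtain L M where "(f has_derivative L) (at z)" "\<forall>c w. L (cscale c w) = c * L w"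
    "(g has_derivative M) (at z)" "\<forall>c w. M (cscale c w) = c * M w" by blast
  thus "\<exists>L. ((\<lambda>z. f z * g z) has_derivative L) (at z) \<and> (\<forall>c w. L (cscale c w) = c * L w)"
    by (intro exI[of _ "\<lambda>w. f z * M w + L w * g z"]) (auto intro!: derivative_eq_intros simp: algebra_simps)
qed

lemma holo_on_diff: "holo_on f U \<Longrightarrow> holo_on g U \<Longrightarrow> holo_on (\<lambda>z. f z - g z) U"
  using holo_on_add[of f U "\<lambda>z. (-1) * g z"] holo_on_mult[OF holo_on_const, of g U "-1"] by simp

lemma holo_on_sum: "(\<And>i. i \<in> I \<Longrightarrow> holo_on (f i) U) \<Longrightarrow> holo_on (\<lambda>z. \<Sum>i\<in>I. f i z) U"
  by (induction I rule: infinite_finite_induct) (auto intro: holo_on_const holo_on_add)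

lemma holo_on_prod: "(\<And>i. i \<in> I \<Longrightarrow> holo_on (f i) U) \<Longrightarrow> holo_on (\<lambda>z. \<Prod>i\<in>I. f i z) U"
  by (induction I rule: infinite_finite_induct) (auto intro: holo_on_const holo_on_mult)

lemma holo_on_power: "holo_on f U \<Longrightarrow> holo_on (\<lambda>z. f z ^ n) U"
  by (induction n) (auto intro: holo_on_const holo_on_mult)

lemma holo_on_compose_entire:
  assumes "holo_on f U" "h holomorphic_on UNIV"
  shows "holo_on (\<lambda>z. h (f z)) U"
  unfolding holo_on_def
proof
  fix z assume "z \<in> U"
  then obtain L where L: "(f has_derivative L) (at z)" "\<forall>c w. L (cscale c w) = c * L w"
    using assms(1) unfolding holo_on_def by blast
  have "(h has_field_derivative deriv h (f z)) (at (f z))"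
    using assms(2) holomorphic_derivI by blast
  hence "((\<lambda>z. h (f z)) has_derivative (\<lambda>w. deriv h (f z) * L w)) (at z)"
    using has_derivative_compose[OF L(1)] unfolding has_field_derivative_def by auto
  thus "\<exists>L. ((\<lambda>z. h (f z)) has_derivative L) (at z) \<and> (\<forall>c w. L (cscale c w) = c * L w)"
    using L(2) by (intro exI[of _ "\<lambda>w. deriv h (f z) * L w"]) auto
qed

lemma holo_on_cong_open:
  assumes "holo_on f U" "open U" "\<And>z. z \<in> U \<Longrightarrow> g z = f z"
  shows "holo_on g U"
  unfolding holo_on_def
proof
  fix z assume z: "z \<in> U"
  then obtain L where L: "(f has_derivative L) (at z)" "\<forall>c w. L (cscale c w) = c * L w"
    using assms(1) unfolding holo_on_def by blast
  have "(g has_derivative L) (at z)"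
    by (rule has_derivative_transform_within_open[OF L(1) assms(2) z]) (simp add: assms(3))
  with L(2) show "\<exists>L. (g has_derivative L) (at z) \<and> (\<forall>c w. L (cscale c w) = c * L w)" by blast
qed

section \<open>Restriction to complex lines and Cauchy integrals over circles\<close>

lemma has_field_derivative_along_line:
  assumes "(f has_derivative L) (at (z + cscale t v))" "\<forall>c w. L (cscale c w) = c * L w"
  shows "((\<lambda>t. f (z + cscale t v)) has_field_derivative L v) (at t)"
proof -
  have "((\<lambda>t. z + cscale t v) has_derivative (\<lambda>t. cscale t v)) (at t)"
    by (auto intro!: derivative_eq_intros bounded_linear_imp_has_derivative bounded_linear_cscale_left)
  from has_derivative_compose[OF this assms(1)]
  have "((\<lambda>t. f (z + cscale t v)) has_derivative (\<lambda>t. t * L v)) (at t)" by (simp only: assms(2))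
  moreover have "(\<lambda>t. t * L v) = (*) (L v)" by (simp add: fun_eq_iff)
  ultimately show ?thesis unfolding has_field_derivative_def by (simp only:)
qed

text \<open>Complex linearity of the derivative is used here. Cauchy's formula, isolated zeros and
  removable singularities all reach several variables through such restrictions.\<close>

lemma holo_on_line:
  assumes "holo_on f U"
  shows "(\<lambda>t. f (z + cscale t v)) holomorphic_on {t. z + cscale t v \<in> U}"
proof (rule holomorphic_onI)
  fix t assume "t \<in> {t. z + cscale t v \<in> U}"
  then obtain L where "(f has_derivative L) (at (z + cscale t v))" "\<forall>c w. L (cscale c w) = c * L w"
    using assms unfolding holo_on_def by blast
  from has_field_derivative_along_line[OF this]
  show "(\<lambda>t. f (z + cscale t v)) field_differentiable at t within {t. z + cscale t v \<in> U}"
    using field_differentiable_at_within field_differentiable_def by blast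
qed

text \<open>As an ordinary integral over \<open>{0..1}\<close>, Cauchy's formula allows the base
  point to vary under the integral sign, by \<open>leibniz_rule\<close> and
  \<open>integral_continuous_on_param\<close>.\<close>

lemma circle_mean_value:
  assumes "g holomorphic_on cball 0 r" "r > 0"
  shows "integral {0..1} (\<lambda>\<theta>. g (of_real r * exp (2 * of_real pi * \<i> * of_real \<theta>))) = g 0"
proof -
  have "((\<lambda>u. g u / (u - 0)) has_contour_integral (2 * of_real pi * \<i> * g 0)) (circlepath 0 r)"
    by (rule Cauchy_integral_circlepath_simple) (use assms in auto)
  hence "integral {0..1} (\<lambda>\<theta>. g (circlepath 0 r \<theta>) / circlepath 0 r \<theta> * vector_derivative (circlepath 0 r) (at \<theta>)) = 2 * of_real pi * \<i> * g 0"
    using contour_integral_unique by (force simp: contour_integral_integral)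
  moreover have "g (circlepath 0 r \<theta>) / circlepath 0 r \<theta> * vector_derivative (circlepath 0 r) (at \<theta>)
      = (2 * of_real pi * \<i>) * g (of_real r * exp (2 * of_real pi * \<i> * of_real \<theta>))" for \<theta>
    using assms(2) unfolding vector_derivative_circlepath by (simp add: circlepath)
  ultimately show ?thesis by simp
qed

lemma circle_derivative_value:
  assumes "g holomorphic_on cball 0 r" "r > 0" "(g has_field_derivative D) (at 0)"
  shows "D = integral {0..1} (\<lambda>\<theta>. g (of_real r * exp (2 * of_real pi * \<i> * of_real \<theta>)) / (of_real r * exp (2 * of_real pi * \<i> * of_real \<theta>)))"
proof -
  have "(g has_field_derivative (1 / (2 * of_real pi * \<i>) * contour_integral(circlepath 0 r) (\<lambda>u. g u / (u-0)^2))) (at 0)"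
    by (rule Cauchy_derivative_integral_circlepath(2))
      (use assms in \<open>auto intro: holomorphic_on_imp_continuous_on holomorphic_on_subset\<close>)
  hence D: "D = 1 / (2 * of_real pi * \<i>) * contour_integral(circlepath 0 r) (\<lambda>u. g u / u^2)"
    using assms(3) DERIV_unique by force
  have eq: "g (circlepath 0 r \<theta>) / (circlepath 0 r \<theta>)^2 * vector_derivative (circlepath 0 r) (at \<theta>)
      = (2 * of_real pi * \<i>) * (g (of_real r * exp (2 * of_real pi * \<i> * of_real \<theta>)) / (of_real r * exp (2 * of_real pi * \<i> * of_real \<theta>)))" for \<theta>
    using assms(2) unfolding vector_derivative_circlepath by (simp add: circlepath power2_eq_square)
  show ?thesis unfolding D contour_integral_integral eq integral_mult_right by simp
qed

text \<open>The Cauchy formula on complex lines expresses each directional derivative as an integral depending continuously on the base point.\<close>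

lemma holo_on_imp_C1:
  fixes f :: "(complex^'n) \<times> complex \<Rightarrow> complex"
  assumes f: "holo_on f U" and U: "open U"
  obtains f' :: "(complex^'n) \<times> complex \<Rightarrow> ((complex^'n) \<times> complex) \<Rightarrow>\<^sub>L complex"
  where "\<And>z. z \<in> U \<Longrightarrow> (f has_derivative blinfun_apply (f' z)) (at z)"
    "\<And>z c w. z \<in> U \<Longrightarrow> blinfun_apply (f' z) (cscale c w) = c * blinfun_apply (f' z) w"
    "continuous_on U f'"
proof -
  from f obtain L where L: "\<And>z. z \<in> U \<Longrightarrow> (f has_derivative L z) (at z)"
    "\<And>z c w. z \<in> U \<Longrightarrow> L z (cscale c w) = c * L z w"
    unfolding holo_on_def by metis
  define f' where "f' z = Blinfun (L z)" for z
  have app: "blinfun_apply (f' z) = L z" if "z \<in> U" for z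
    unfolding f'_def using L(1)[OF that] by (auto intro: bounded_linear_Blinfun_apply has_derivative_bounded_linear)
  have "continuous_on U f'"
  proof (rule continuous_on_blinfun_componentwise)
    fix b :: "(complex^'n) \<times> complex" assume b: "b \<in> Basis"
    hence nb: "norm b = 1" by auto
    have "continuous (at z0) (\<lambda>z. blinfun_apply (f' z) b)" if z0: "z0 \<in> U" for z0
    proof -
      obtain e0 where e0: "e0 > 0" "cball z0 e0 \<subseteq> U" using U z0 open_contains_cball by blast
      \<comment> \<open>Half of \<open>e0\<close> is reserved for moving the base point and half for
        the radius, so that every circle stays inside \<open>U\<close>.\<close>
      define e where "e = e0 / 2"
      have e: "e > 0" using e0 by (simp add: e_def)
      have inU: "z + cscale t b \<in> U" if "z \<in> ball z0 e" "norm t \<le> e" for z t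
      proof -
        have "dist z0 (z + cscale t b) \<le> dist z0 z + dist z (z + cscale t b)" by (rule dist_triangle)
        also have "dist z (z + cscale t b) = norm t" by (simp add: dist_norm norm_cscale nb)
        finally show ?thesis using that e0(2) by (auto simp: e_def)
      qed
      let ?g = "\<lambda>z \<theta>. f (z + cscale (of_real e * exp (2 * of_real pi * \<i> * of_real \<theta>)) b) / (of_real e * exp (2 * of_real pi * \<i> * of_real \<theta>))"
      have eq: "blinfun_apply (f' z) b = integral {0..1} (?g z)" if z: "z \<in> ball z0 e" for z
      proof -
        have zU: "z \<in> U" using inU[OF z, of 0] e by simp
        show ?thesis unfolding app[OF zU]
        proof (rule circle_derivative_value)
          show "(\<lambda>t. f (z + cscale t b)) holomorphic_on cball 0 e"
            by (rule holomorphic_on_subset[OF holo_on_line[OF f]]) (use inU[OF z] in auto)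
          show "((\<lambda>t. f (z + cscale t b)) has_field_derivative L z b) (at 0)"
            by (rule has_field_derivative_along_line) (use L[OF zU] in auto)
        qed (rule e)
      qed
      have "continuous_on (ball z0 e) (\<lambda>z. integral (cbox 0 1) (?g z))"
      proof (rule integral_continuous_on_param)
        show "continuous_on (ball z0 e \<times> cbox 0 1) (\<lambda>(z, \<theta>). ?g z \<theta>)"
          unfolding split_beta using e
          by (intro continuous_intros continuous_on_compose2[OF holo_on_imp_continuous_on[OF f]])
            (auto intro!: inU simp: norm_mult)
      qed
      hence "continuous_on (ball z0 e) (\<lambda>z. blinfun_apply (f' z) b)"
        by (rule continuous_on_eq) (simp add: eq)
      thus ?thesis using e by (meson centre_in_ball continuous_on_eq_continuous_at open_ball)
    qed
    thus "continuous_on U (\<lambda>z. blinfun_apply (f' z) b)" by (rule continuous_at_imp_continuous_on[rule_format])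
  qed
  with L app show ?thesis by (intro that[of f']) auto
qed

text \<open>Differentiation under the integral needs a derivative jointly continuous in the point
  and the angle, which \<open>holo_on_imp_C1\<close> provides. Complex linearity survives because
  integration commutes with evaluating the derivative at a vector.\<close>

lemma holo_on_circle_mean:
  fixes f :: "(complex^'n) \<times> complex \<Rightarrow> complex"
  assumes f: "holo_on f U" and U: "open U" and W: "open W" "convex W"
    and WU: "\<And>z \<theta>. z \<in> W \<Longrightarrow> z + cscale (of_real r * exp (2 * of_real pi * \<i> * of_real \<theta>)) v \<in> U"
  shows "holo_on (\<lambda>z. integral {0..1} (\<lambda>\<theta>. f (z + cscale (of_real r * exp (2 * of_real pi * \<i> * of_real \<theta>)) v))) W"
  unfolding holo_on_def
proof
  fix z0 assume z0: "z0 \<in> W"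
  obtain f' where f': "\<And>z. z \<in> U \<Longrightarrow> (f has_derivative blinfun_apply (f' z)) (at z)"
    "\<And>z c w. z \<in> U \<Longrightarrow> blinfun_apply (f' z) (cscale c w) = c * blinfun_apply (f' z) w"
    "continuous_on U f'" using holo_on_imp_C1[OF f U] by blast
  define s where "s \<theta> = cscale (of_real r * exp (2 * of_real pi * \<i> * of_real \<theta>)) v" for \<theta> :: real
  have sU: "z + s \<theta> \<in> U" if "z \<in> W" for z \<theta> using WU[OF that] by (simp add: s_def)
  have cs: "continuous_on S s" for S unfolding s_def by (intro continuous_intros)
  have cf': "continuous_on (W \<times> cbox 0 1) (\<lambda>(z, \<theta>). f' (z + s \<theta>))"
    unfolding split_beta
    by (intro continuous_on_compose2[OF f'(3)] continuous_intros continuous_on_compose2[OF cs[of UNIV]]) (auto intro: sU)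
  have "((\<lambda>z. integral (cbox 0 1) (\<lambda>\<theta>. f (z + s \<theta>))) has_derivative blinfun_apply (integral (cbox 0 1) (\<lambda>\<theta>. f' (z0 + s \<theta>)))) (at z0 within W)"
  proof (rule leibniz_rule[OF _ _ cf' z0 W(2)])
    fix z and t :: real assume z: "z \<in> W"
    have "((\<lambda>z. z + s t) has_derivative (\<lambda>x. x)) (at z)" by (auto intro!: derivative_eq_intros)
    from has_derivative_compose[OF this f'(1)[OF sU[OF z]]]
    show "((\<lambda>z. f (z + s t)) has_derivative blinfun_apply (f' (z + s t))) (at z within W)"
      by (simp add: has_derivative_at_withinI)
  next
    fix z assume z: "z \<in> W"
    show "(\<lambda>\<theta>. f (z + s \<theta>)) integrable_on cbox 0 1"
      by (intro integrable_continuous continuous_on_compose2[OF holo_on_imp_continuous_on[OF f]] continuous_intros cs) (use sU[OF z] in blast)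
  qed
  hence 1: "((\<lambda>z. integral {0..1} (\<lambda>\<theta>. f (z + s \<theta>))) has_derivative blinfun_apply (integral {0..1} (\<lambda>\<theta>. f' (z0 + s \<theta>)))) (at z0)"
    unfolding at_within_open[OF z0 W(1)] cbox_interval .
  have int: "(\<lambda>\<theta>. f' (z0 + s \<theta>)) integrable_on {0..1}"
    unfolding cbox_interval[symmetric]
    by (intro integrable_continuous continuous_on_compose2[OF f'(3)] continuous_intros cs) (use sU[OF z0] in blast)
  have "blinfun_apply (integral {0..1} (\<lambda>\<theta>. f' (z0 + s \<theta>))) w = integral {0..1} (\<lambda>\<theta>. blinfun_apply (f' (z0 + s \<theta>)) w)" for w
    using blinfun_apply_integral[OF int] by simp
  hence "blinfun_apply (integral {0..1} (\<lambda>\<theta>. f' (z0 + s \<theta>))) (cscale c w) = c * blinfun_apply (integral {0..1} (\<lambda>\<theta>. f' (z0 + s \<theta>))) w" for c w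
    by (simp add: f'(2)[OF sU[OF z0]])
  with 1 show "\<exists>L. ((\<lambda>z. integral {0..1} (\<lambda>\<theta>. f (z + cscale (of_real r * exp (2 * of_real pi * \<i> * of_real \<theta>)) v))) has_derivative L) (at z0) \<and> (\<forall>c w. L (cscale c w) = c * L w)"
    unfolding s_def by blast
qed
section \<open>Identity theorem and Riemann extension\<close>

text \<open>The complex line from a point of \<open>W\<close> to \<open>z\<close> meets
  \<open>U\<close> in a convex plane set, where one-variable analytic continuation applies.\<close>

lemma holo_zero_convex:
  fixes f :: "(complex^'n) \<times> complex \<Rightarrow> complex"
  assumes f: "holo_on f U" and U: "open U" "convex U"
    and W: "open W" "W \<noteq> {}" "W \<subseteq> U" "\<And>z. z \<in> W \<Longrightarrow> f z = 0" and z: "z \<in> U"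
  shows "f z = 0"
proof -
  obtain w where w: "w \<in> W" using W(2) by blast
  define l where "l t = w + cscale t (z - w)" for t
  have cl: "continuous_on S l" for S unfolding l_def by (intro continuous_intros)
  have op: "open (l -` X)" if "open X" for X
    using that cl[of UNIV] by (simp add: continuous_on_open_vimage)
  have "convex (l -` U)"
  proof (rule convexI)
    fix s t :: complex and a b :: real
    assume st: "s \<in> l -` U" "t \<in> l -` U" and ab: "0 \<le> a" "0 \<le> b" "a + b = 1"
    have "l (a *\<^sub>R s + b *\<^sub>R t) = (a + b) *\<^sub>R w + (a *\<^sub>R cscale s (z - w) + b *\<^sub>R cscale t (z - w))"
      using ab(3) by (simp only: l_def cscale_add_left cscale_scaleR scaleR_one)
    also have "\<dots> = a *\<^sub>R l s + b *\<^sub>R l t"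
      by (simp add: l_def algebra_simps)
    finally show "a *\<^sub>R s + b *\<^sub>R t \<in> l -` U" using convexD[OF U(2), of "l s" "l t"] st ab by simp
  qed
  hence con: "connected (l -` U)" by (rule convex_connected)
  have "f (l 1) = 0"
  proof (rule analytic_continuation_open[where s = "l -` W" and s' = "l -` U" and f = "\<lambda>t. f (l t)" and g = "\<lambda>_. 0"])
    have "0 \<in> l -` W" using w by (simp add: l_def)
    thus "l -` W \<noteq> {}" by blast
    show "(\<lambda>t. f (l t)) holomorphic_on l -` U"
      using holo_on_line[OF f, of w "z - w"] by (simp add: l_def vimage_def)
  qed (use op U W con z in \<open>auto simp: l_def\<close>)
  thus ?thesis by (simp add: l_def)
qed

lemma holo_nonzero_dense:
  fixes g :: "(complex^'n) \<times> complex \<Rightarrow> complex"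
  assumes g: "holo_on g UNIV" and z1: "g z1 \<noteq> 0" and U: "open U" "U \<noteq> {}"
  obtains z where "z \<in> U" "g z \<noteq> 0"
  using holo_zero_convex[OF g open_UNIV convex_UNIV U, of z1] z1 by blast

lemma open_holo_nonzero:
  assumes "holo_on g UNIV" shows "open {z. g z \<noteq> 0}"
  by (intro open_Collect_neq holo_on_imp_continuous_on[OF assms] continuous_intros)

text \<open>Two points off the zero set span a complex line that meets it in a countable set only,
  and the plane minus a countable set is connected.\<close>

lemma connected_holo_nonzero:
  fixes g :: "(complex^'n) \<times> complex \<Rightarrow> complex"
  assumes g: "holo_on g UNIV"
  shows "connected {z. g z \<noteq> 0}"
  unfolding connected_iff_connected_component
proof (intro ballI)
  fix x y assume x: "x \<in> {z. g z \<noteq> 0}" and y: "y \<in> {z. g z \<noteq> 0}"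
  define l where "l t = x + cscale t (y - x)" for t
  have cl: "continuous_on S l" for S unfolding l_def by (intro continuous_intros)
  have hol: "(\<lambda>t. g (l t)) holomorphic_on UNIV"
    using holo_on_line[OF g, of x "y - x"] by (simp add: l_def)
  have "countable {t \<in> UNIV. g (l t) = 0}"
  proof (cases "(\<lambda>t. g (l t)) constant_on UNIV")
    case True
    hence "g (l t) = g (l 0)" for t by (metis UNIV_I constant_on_def)
    hence "{t \<in> UNIV. g (l t) = 0} = {}" using x by (auto simp: l_def)
    thus ?thesis by (metis countable_empty)
  qed (intro holomorphic_countable_zeros hol, auto)
  hence "connected (UNIV - {t. g (l t) = 0})"
    by (intro connected_open_diff_countable) auto
  hence "connected (l ` (UNIV - {t. g (l t) = 0}))" by (intro connected_continuous_image cl)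
  moreover have "x = l 0" "y = l 1" by (auto simp: l_def)
  ultimately show "connected_component {z. g z \<noteq> 0} x y"
    unfolding connected_component_def using x y by (intro exI[of _ "l ` (UNIV - {t. g (l t) = 0})"]) auto
qed

text \<open>On a complex line through \<open>z0\<close> on which \<open>g\<close> is not identically zero, the extension is the mean value of \<open>f\<close> over a small circle avoiding the zeros of \<open>g\<close>; the same circle works for all lines parallel to it through nearby points.\<close>

lemma riemann_extension_local:
  fixes f g :: "(complex^'n) \<times> complex \<Rightarrow> complex"
  assumes g: "holo_on g UNIV" and z1: "g z1 \<noteq> 0"
    and f: "holo_on f {z. g z \<noteq> 0}"
    and bdd: "\<And>z. \<exists>U C. open U \<and> z \<in> U \<and> (\<forall>w\<in>U. g w \<noteq> 0 \<longrightarrow> norm (f w) \<le> C)"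
  obtains e F where "e > 0" "holo_on F (ball z0 e)" "\<And>z. z \<in> ball z0 e \<Longrightarrow> g z \<noteq> 0 \<Longrightarrow> F z = f z"
proof -
  \<comment> \<open>Aiming at \<open>z1\<close> keeps \<open>g\<close> from vanishing identically on
    the line through \<open>z0\<close>: it is nonzero at parameter 1.\<close>
  define v where "v = z1 - z0"
  have hol: "(\<lambda>t. g (z + cscale t v)) holomorphic_on UNIV" for z
    using holo_on_line[OF g, of z v] by simp
  have cl: "continuous_on S (\<lambda>t. z + cscale t v)" for S z by (intro continuous_intros)
  obtain \<rho> where \<rho>: "\<rho> > 0" "\<And>t. t \<in> ball 0 \<rho> - {0} \<Longrightarrow> g (z0 + cscale t v) \<noteq> 0"
  proof (cases "g z0 = 0")
    case True
    from isolated_zeros[OF hol[of z0], of 0 1] True z1 show ?thesis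
      using that by (auto simp: v_def)
  next
    case False
    have "open {t. g (z0 + cscale t v) \<noteq> 0}"
      by (intro open_Collect_neq holomorphic_on_imp_continuous_on[OF hol] continuous_intros)
    with False obtain \<rho> where "\<rho> > 0" "ball 0 \<rho> \<subseteq> {t. g (z0 + cscale t v) \<noteq> 0}"
      by (metis (mono_tags, lifting) add.right_neutral cscale_0 mem_Collect_eq open_contains_ball)
    thus ?thesis using that by blast
  qed
  define r where "r = \<rho> / 2"
  have r: "r > 0" "r < \<rho>" using \<rho> by (auto simp: r_def)
  have "compact ((\<lambda>t. z0 + cscale t v) ` sphere 0 r)" by (intro compact_continuous_image cl) simp
  moreover have "(\<lambda>t. z0 + cscale t v) ` sphere 0 r \<subseteq> {z. g z \<noteq> 0}" using \<rho>(2) r by auto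
  ultimately obtain e where e: "e > 0" "(\<Union>x\<in>(\<lambda>t. z0 + cscale t v) ` sphere 0 r. ball x e) \<subseteq> {z. g z \<noteq> 0}"
    using compact_subset_open_imp_ball_epsilon_subset[OF _ open_holo_nonzero[OF g]] by metis
  have circ: "g (z + cscale t v) \<noteq> 0" if "z \<in> ball z0 e" "norm t = r" for z t
  proof -
    have "z + cscale t v \<in> ball (z0 + cscale t v) e" using that by (simp add: dist_norm)
    moreover have "z0 + cscale t v \<in> (\<lambda>t. z0 + cscale t v) ` sphere 0 r" using that(2) by (intro imageI) simp
    ultimately have "z + cscale t v \<in> {z. g z \<noteq> 0}" using e(2) by blast
    thus ?thesis by simp
  qed
  define F where "F z = integral {0..1} (\<lambda>\<theta>. f (z + cscale (of_real r * exp (2 * of_real pi * \<i> * of_real \<theta>)) v))" for z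
  have "holo_on F (ball z0 e)"
    unfolding F_def
    by (rule holo_on_circle_mean[OF f open_holo_nonzero[OF g] open_ball convex_ball])
      (use circ r in \<open>auto simp: norm_mult\<close>)
  moreover have "F z = f z" if z: "z \<in> ball z0 e" and gz: "g z \<noteq> 0" for z
  proof -
    define X where "X = {t \<in> cball 0 r. g (z + cscale t v) = 0}"
    have finX: "finite X"
    proof (cases "(\<lambda>t. g (z + cscale t v)) constant_on UNIV")
      case True
      hence "g (z + cscale t v) = g (z + cscale 0 v)" for t by (metis UNIV_I constant_on_def)
      hence "X = {}" using gz by (auto simp: X_def)
      thus ?thesis by simp
    next
      case False
      show ?thesis unfolding X_def
        by (rule holomorphic_compact_finite_zeros[OF hol _ _ _ _ False]) auto
    qed
    have XB: "X \<subseteq> ball 0 r" using circ[OF z] by (force simp: X_def)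
    have "(\<lambda>t. f (z + cscale t v)) holomorphic_on cball 0 r - X"
      by (rule holomorphic_on_subset[OF holo_on_line[OF f]]) (auto simp: X_def)
    \<comment> \<open>The finitely many other zeros are cut out of the neighbourhood, so
      \<open>g\<close> is nonzero on it except at \<open>t\<close>, and the local bound on
      \<open>f\<close> makes the singularity removable.\<close>
    moreover have "(\<lambda>t. f (z + cscale t v)) \<in> O[at t](\<lambda>_. 1)" if t: "t \<in> X" for t
    proof -
      obtain U C where U: "open U" "z + cscale t v \<in> U" "\<forall>w\<in>U. g w \<noteq> 0 \<longrightarrow> norm (f w) \<le> C"
        using bdd by blast
      have "open ((\<lambda>t. z + cscale t v) -` U)" using U(1) cl[of UNIV] by (simp add: continuous_on_open_vimage)
      hence "open ((\<lambda>t. z + cscale t v) -` U \<inter> (ball 0 r - (X - {t})))"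
        using finX by (intro open_Int open_Diff) (auto intro: finite_imp_closed)
      moreover have "t \<in> (\<lambda>t. z + cscale t v) -` U \<inter> (ball 0 r - (X - {t}))" using U(2) t XB by auto
      ultimately have "eventually (\<lambda>s. s \<in> (\<lambda>t. z + cscale t v) -` U \<inter> (ball 0 r - (X - {t}))) (at t)"
        using eventually_at_topological by blast
      hence "eventually (\<lambda>s. norm (f (z + cscale s v)) \<le> C * norm (1::complex)) (at t)"
        using eventually_neq_at_within[of t t UNIV]
      proof eventually_elim
        case (elim s)
        hence "g (z + cscale s v) \<noteq> 0" by (auto simp: X_def)
        with elim U(3) show ?case by auto
      qed
      thus ?thesis by (rule bigoI)
    qed
    ultimately obtain G where G: "G holomorphic_on cball 0 r" "\<forall>t\<in>cball 0 r - X. G t = f (z + cscale t v)"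
      using removable_singularities[OF finX, of "cball 0 r" "\<lambda>t. f (z + cscale t v)"] XB by auto
    have "F z = integral {0..1} (\<lambda>\<theta>. G (of_real r * exp (2 * of_real pi * \<i> * of_real \<theta>)))"
      unfolding F_def
    proof (rule integral_cong)
      fix \<theta> :: real
      have n: "norm (of_real r * exp (2 * of_real pi * \<i> * of_real \<theta>)) = r" using r by (simp add: norm_mult)
      hence "of_real r * exp (2 * of_real pi * \<i> * of_real \<theta>) \<in> cball 0 r - X" using XB by auto
      thus "f (z + cscale (of_real r * exp (2 * of_real pi * \<i> * of_real \<theta>)) v) = G (of_real r * exp (2 * of_real pi * \<i> * of_real \<theta>))"
        using G(2) by simp
    qed
    also have "\<dots> = G 0" by (rule circle_mean_value[OF G(1) r(1)])
    also have "\<dots> = f z" using G(2) r gz by (auto simp: X_def)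
    finally show ?thesis .
  qed
  ultimately show ?thesis using that e(1) by blast
qed

text \<open>Two local extensions are continuous and both equal \<open>f\<close> off the zeros of
  \<open>g\<close>, a dense set, so they agree on overlaps. The diagonal choice \<open>F z z\<close>
  is therefore holomorphic near every point.\<close>

lemma riemann_extension:
  fixes f g :: "(complex^'n) \<times> complex \<Rightarrow> complex"
  assumes g: "holo_on g UNIV" and z1: "g z1 \<noteq> 0"
    and f: "holo_on f {z. g z \<noteq> 0}"
    and bdd: "\<And>z. \<exists>U C. open U \<and> z \<in> U \<and> (\<forall>w\<in>U. g w \<noteq> 0 \<longrightarrow> norm (f w) \<le> C)"
  obtains F where "holo_on F UNIV" "\<And>z. g z \<noteq> 0 \<Longrightarrow> F z = f z"
proof -
  have "\<exists>e F. e > 0 \<and> holo_on F (ball z0 e) \<and> (\<forall>z\<in>ball z0 e. g z \<noteq> 0 \<longrightarrow> F z = f z)" for z0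
    by (rule riemann_extension_local[OF g z1 f bdd, of z0]) blast
  then obtain e F where eF: "\<And>z0. e z0 > (0::real)" "\<And>z0. holo_on (F z0) (ball z0 (e z0))"
    "\<And>z0 z. z \<in> ball z0 (e z0) \<Longrightarrow> g z \<noteq> 0 \<Longrightarrow> F z0 z = f z"
    by metis
  define H where "H z = F z z" for z
  have eq: "H z = F z0 z" if z: "z \<in> ball z0 (e z0)" for z z0
  proof (rule ccontr)
    assume ne: "H z \<noteq> F z0 z"
    define W where "W = ball z (e z) \<inter> ball z0 (e z0)"
    have cd: "continuous_on W (\<lambda>w. F z w - F z0 w)"
      by (intro continuous_intros continuous_on_subset[OF holo_on_imp_continuous_on[OF eF(2)]]) (auto simp: W_def)
    have "open W" by (simp add: W_def open_Int)
    hence "open (W \<inter> (\<lambda>w. F z w - F z0 w) -` (- {0}))"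
      using cd by (intro continuous_open_preimage) auto
    moreover have "z \<in> W \<inter> (\<lambda>w. F z w - F z0 w) -` (- {0})"
      using z ne eF(1)[of z] by (auto simp: W_def H_def)
    hence "W \<inter> (\<lambda>w. F z w - F z0 w) -` (- {0}) \<noteq> {}" by blast
    ultimately obtain w where "w \<in> W \<inter> (\<lambda>w. F z w - F z0 w) -` (- {0})" "g w \<noteq> 0"
      by (rule holo_nonzero_dense[OF g z1])
    hence "w \<in> W" "F z w \<noteq> F z0 w" "g w \<noteq> 0" by auto
    thus False using eF(3)[of w z] eF(3)[of w z0] by (auto simp: W_def)
  qed
  have "holo_on H UNIV"
    unfolding holo_on_def
  proof
    fix z0 :: "(complex^'n) \<times> complex"
    have "holo_on H (ball z0 (e z0))" by (rule holo_on_cong_open[OF eF(2)]) (auto simp: eq)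
    thus "\<exists>L. (H has_derivative L) (at z0) \<and> (\<forall>c w. L (cscale c w) = c * L w)"
      using eF(1)[of z0] unfolding holo_on_def by auto
  qed
  moreover have "H z = f z" if "g z \<noteq> 0" for z using eF(3)[of z z] eF(1)[of z] that by (simp add: H_def)
  ultimately show ?thesis using that by blast
qed

section \<open>Analytic sets\<close>

lemma analytic_setE:
  assumes "analytic_set A"
  obtains U F where "open U" "z \<in> U" "finite F" "\<forall>f\<in>F. holo_on f U" "A \<inter> U = {w\<in>U. \<forall>f\<in>F. f w = 0}"
  using spec[OF assms[unfolded analytic_set_def], of z] by (elim exE conjE)

lemma analytic_set_zeros: "holo_on f UNIV \<Longrightarrow> analytic_set {z. f z = 0}"
  unfolding analytic_set_def by (intro allI exI[of _ UNIV] exI[of _ "{f}"]) auto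

lemma analytic_set_empty: "analytic_set {}"
  using analytic_set_zeros[OF holo_on_const[of 1]] by simp

lemma closed_analytic_set:
  assumes A: "analytic_set A" shows "closed A"
proof -
  have "\<exists>T. open T \<and> z \<in> T \<and> T \<subseteq> - A" if z: "z \<in> - A" for z
  proof -
    obtain U F where U: "open U" "z \<in> U" "finite F" "\<forall>f\<in>F. holo_on f U" "A \<inter> U = {w\<in>U. \<forall>f\<in>F. f w = 0}"
      by (rule analytic_setE[OF A, of z])
    obtain f where f: "f \<in> F" "f z \<noteq> 0" using z U(2,5) by blast
    have "open (U \<inter> f -` (- {0}))"
      using U(1,4) f(1) by (intro continuous_open_preimage holo_on_imp_continuous_on) auto
    moreover have "U \<inter> f -` (- {0}) \<subseteq> - A" using U(5) f(1) by auto
    ultimately show ?thesis using f U(2) by blast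
  qed
  thus ?thesis unfolding closed_def by (subst open_subopen) auto
qed

lemma analytic_set_Int:
  assumes "analytic_set A" "analytic_set B" shows "analytic_set (A \<inter> B)"
  unfolding analytic_set_def
proof
  fix z
  obtain U F where U: "open U" "z \<in> U" "finite F" "\<forall>f\<in>F. holo_on f U" "A \<inter> U = {w\<in>U. \<forall>f\<in>F. f w = 0}"
    by (rule analytic_setE[OF assms(1), of z])
  obtain W G where W: "open W" "z \<in> W" "finite G" "\<forall>f\<in>G. holo_on f W" "B \<inter> W = {w\<in>W. \<forall>f\<in>G. f w = 0}"
    by (rule analytic_setE[OF assms(2), of z])
  have hol: "\<forall>f\<in>F \<union> G. holo_on f (U \<inter> W)" using U(4) W(4) holo_on_subset by blast
  have "(A \<inter> B) \<inter> (U \<inter> W) = (A \<inter> U) \<inter> (B \<inter> W)" by auto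
  also have "\<dots> = {w\<in>U \<inter> W. \<forall>f\<in>F \<union> G. f w = 0}" unfolding U(5) W(5) by auto
  finally show "\<exists>U F. open U \<and> z \<in> U \<and> finite F \<and> (\<forall>f\<in>F. holo_on f U) \<and> A \<inter> B \<inter> U = {w\<in>U. \<forall>f\<in>F. f w = 0}"
    using U(1-3) W(1-3) hol by (intro exI[of _ "U \<inter> W"] exI[of _ "F \<union> G"]) (simp add: open_Int)
qed

lemma analytic_set_Un:
  assumes "analytic_set A" "analytic_set B" shows "analytic_set (A \<union> B)"
  unfolding analytic_set_def
proof
  fix z
  obtain U F where U: "open U" "z \<in> U" "finite F" "\<forall>f\<in>F. holo_on f U" "A \<inter> U = {w\<in>U. \<forall>f\<in>F. f w = 0}"
    by (rule analytic_setE[OF assms(1), of z])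
  obtain W G where W: "open W" "z \<in> W" "finite G" "\<forall>f\<in>G. holo_on f W" "B \<inter> W = {w\<in>W. \<forall>f\<in>G. f w = 0}"
    by (rule analytic_setE[OF assms(2), of z])
  \<comment> \<open>All products of a function in \<open>F\<close> with one in \<open>G\<close>
    vanish at a point exactly when all of \<open>F\<close> or all of \<open>G\<close> does.\<close>
  define H where "H = (\<lambda>(f, g) z. f z * g z) ` (F \<times> G)"
  have "holo_on (\<lambda>z. f z * g z) (U \<inter> W)" if "f \<in> F" "g \<in> G" for f g
    using that U(4) W(4) by (intro holo_on_mult) (meson holo_on_subset inf_le1 inf_le2)+
  hence hol: "\<forall>h\<in>H. holo_on h (U \<inter> W)" unfolding H_def by (simp add: split_beta)
  have "(\<forall>h\<in>H. h w = 0) \<longleftrightarrow> (\<forall>f\<in>F. \<forall>g\<in>G. f w = 0 \<or> g w = 0)" for w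
    unfolding H_def by (simp add: split_beta)
  hence H: "(\<forall>h\<in>H. h w = 0) \<longleftrightarrow> (\<forall>f\<in>F. f w = 0) \<or> (\<forall>g\<in>G. g w = 0)" for w by blast
  have "(A \<union> B) \<inter> (U \<inter> W) = ((A \<inter> U) \<inter> W) \<union> ((B \<inter> W) \<inter> U)" by auto
  also have "\<dots> = {w\<in>U \<inter> W. \<forall>f\<in>H. f w = 0}" unfolding U(5) W(5) H by auto
  finally show "\<exists>U F. open U \<and> z \<in> U \<and> finite F \<and> (\<forall>f\<in>F. holo_on f U) \<and> (A \<union> B) \<inter> U = {w\<in>U. \<forall>f\<in>F. f w = 0}"
    using U(1-3) W(1-3) hol by (intro exI[of _ "U \<inter> W"] exI[of _ H]) (auto simp: H_def)
qed

lemma analytic_set_finite_Union: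
  "finite \<Z> \<Longrightarrow> (\<And>Z. Z \<in> \<Z> \<Longrightarrow> analytic_set Z) \<Longrightarrow> analytic_set (\<Union>\<Z>)"
  by (induction \<Z> rule: finite_induct) (auto intro: analytic_set_empty analytic_set_Un)

lemma irreducible_subset_Un:
  assumes irr: "irreducible_analytic A" and an: "analytic_set B" "analytic_set C" and sub: "A \<subseteq> B \<union> C"
  shows "A \<subseteq> B \<or> A \<subseteq> C"
proof (rule ccontr)
  assume "\<not> (A \<subseteq> B \<or> A \<subseteq> C)"
  \<comment> \<open>Nonemptiness comes from the same negation: if \<open>A\<close> missed
    \<open>B\<close>, it would lie in \<open>C\<close>, and conversely.\<close>
  hence "A \<inter> B \<subset> A" "A \<inter> C \<subset> A" "A \<inter> B \<noteq> {}" "A \<inter> C \<noteq> {}" "A = (A \<inter> B) \<union> (A \<inter> C)"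
    using sub by auto
  thus False using irr an unfolding irreducible_analytic_def by (meson analytic_set_Int)
qed

lemma irreducible_subset_finite_Union:
  assumes irr: "irreducible_analytic A" and fin: "finite \<Z>"
    and an: "\<And>Z. Z \<in> \<Z> \<Longrightarrow> analytic_set Z" and sub: "A \<subseteq> \<Union>\<Z>"
  obtains Z where "Z \<in> \<Z>" "A \<subseteq> Z"
proof -
  have "A \<subseteq> \<Union>\<Z> \<longrightarrow> (\<exists>Z\<in>\<Z>. A \<subseteq> Z)" using fin an
  proof (induction \<Z> rule: finite_induct)
    case empty
    thus ?case using irr by (auto simp: irreducible_analytic_def)
  next
    case (insert Z \<Z>)
    show ?case
    proof
      assume "A \<subseteq> \<Union>(insert Z \<Z>)"
      hence "A \<subseteq> Z \<or> A \<subseteq> \<Union>\<Z>"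
        using irreducible_subset_Un[OF irr insert.prems[of Z] analytic_set_finite_Union[OF insert.hyps(1)]] insert.prems
        by auto
      thus "\<exists>Z\<in>insert Z \<Z>. A \<subseteq> Z" using insert by blast
    qed
  qed
  thus ?thesis using sub that by blast
qed

section \<open>Roots of monic polynomials\<close>

text \<open>The value at \<open>a\<close> has modulus equal to the product of the distances from
  \<open>a\<close> to the roots, which is at least \<open>r ^ degree p\<close> if none is closer
  than \<open>r\<close>. This replaces any appeal to Rouche's theorem.\<close>

lemma monic_root_near:
  fixes p :: "complex poly"
  assumes "lead_coeff p = 1" "norm (poly p a) < r ^ degree p" "r > 0"
  obtains x where "poly p x = 0" "dist a x < r"
proof -
  obtain as where as: "Polynomial.smult (lead_coeff p) (\<Prod>a\<leftarrow>as. [:- a, 1:]) = p" "length as = degree p"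
    using fundamental_theorem_algebra_factorized by blast
  have pl: "poly (\<Prod>a\<leftarrow>xs. [:- a, 1:]) y = (\<Prod>a\<leftarrow>xs. y - a)" for xs and y :: complex
    by (induction xs) (auto simp: algebra_simps)
  have "r ^ length xs \<le> norm (\<Prod>x\<leftarrow>xs. a - x)" if "\<forall>x\<in>set xs. \<not> dist a x < r" for xs
    using that
  proof (induction xs)
    case (Cons x xs)
    have "r * r ^ length xs \<le> norm (a - x) * norm (\<Prod>x\<leftarrow>xs. a - x)"
      using Cons assms(3) by (intro mult_mono) (auto simp: dist_norm)
    thus ?case by (simp add: norm_mult)
  qed simp
  moreover have py: "poly p y = (\<Prod>a\<leftarrow>as. y - a)" for y using as(1) assms(1) pl by (metis smult_1_left)
  ultimately obtain x where x: "x \<in> set as" "dist a x < r" using assms(2) as(2) by (metis not_le)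
  have "poly p x = 0" unfolding py using x(1) by (simp add: prod_list_zero_iff)
  thus ?thesis using x(2) that by blast
qed

text \<open>The discs are disjoint and as many as the degree, so each holds exactly one root and no
  root lies elsewhere. It serves for the local branches and again for the eigenvalues near the
  centres.\<close>

lemma monic_roots_in_discs:
  fixes p :: "complex poly" and c :: "'i \<Rightarrow> complex"
  assumes p: "lead_coeff p = 1" and I: "finite I" "card I = degree p"
    and sep: "\<And>i j. i \<in> I \<Longrightarrow> j \<in> I \<Longrightarrow> i \<noteq> j \<Longrightarrow> 2 * r \<le> dist (c i) (c j)"
    and ex: "\<And>i. i \<in> I \<Longrightarrow> \<exists>x. poly p x = 0 \<and> dist (c i) x < r"
  shows "\<exists>\<rho>. (\<forall>i\<in>I. dist (c i) (\<rho> i) < r \<and> (\<forall>x. poly p x = 0 \<and> dist (c i) x < r \<longrightarrow> x = \<rho> i))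
    \<and> inj_on \<rho> I \<and> {x. poly p x = 0} = \<rho> ` I"
proof -
  obtain \<rho> where \<rho>: "\<And>i. i \<in> I \<Longrightarrow> poly p (\<rho> i) = 0 \<and> dist (c i) (\<rho> i) < r" using ex by metis
  have sep2: "i = j" if "i \<in> I" "j \<in> I" "dist (c i) x < r" "dist (c j) x < r" for i j x
    using dist_triangle2[of "c i" "c j" x] sep[of i j] that by linarith
  have inj: "inj_on \<rho> I" by (rule inj_onI) (metis \<rho> sep2)
  have p0: "p \<noteq> 0" using p by auto
  have fin: "finite {x. poly p x = 0}" by (rule poly_roots_finite[OF p0])
  have eq: "\<rho> ` I = {x. poly p x = 0}"
  proof (rule card_seteq[OF fin])
    show "\<rho> ` I \<subseteq> {x. poly p x = 0}" using \<rho> by auto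
    show "card {x. poly p x = 0} \<le> card (\<rho> ` I)"
      using card_poly_roots_bound[OF p0] I(2) card_image[OF inj] by simp
  qed
  have "x = \<rho> i" if i: "i \<in> I" and x: "poly p x = 0" "dist (c i) x < r" for i x
  proof -
    obtain j where "j \<in> I" "x = \<rho> j" using eq x(1) by blast
    thus ?thesis using sep2[of i j x] i x(2) \<rho> by auto
  qed
  thus ?thesis using \<rho> inj eq by blast
qed

text \<open>The leading terms cancel in the difference of the two sides, so it cannot have
  \<open>degree p\<close> roots unless it is zero.\<close>

lemma monic_distinct_roots_prod:
  fixes p :: "complex poly"
  assumes p: "lead_coeff p = 1" "card {x. poly p x = 0} = degree p"
  shows "p = (\<Prod>x\<in>{x. poly p x = 0}. [:-x, 1:])"
proof -
  define R where "R = {x. poly p x = 0}"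
  define q where "q = (\<Prod>x\<in>R. [:-x, 1:])"
  have fin: "finite R" unfolding R_def using p(1) by (intro poly_roots_finite) auto
  have dq: "degree q = degree p" unfolding q_def using p(2)
    by (subst degree_prod_eq_sum_degree) (auto simp: R_def)
  have lq: "lead_coeff q = 1" unfolding q_def lead_coeff_prod by simp
  have "p - q = 0"
  proof (rule ccontr)
    assume ne: "p - q \<noteq> 0"
    have "R \<subseteq> {x. poly (p - q) x = 0}" using fin by (auto simp: R_def q_def poly_prod)
    hence "card R \<le> card {x. poly (p - q) x = 0}" by (intro card_mono poly_roots_finite ne)
    hence le: "degree p \<le> degree (p - q)" using card_poly_roots_bound[OF ne] p(2) by (simp add: R_def)
    have "coeff (p - q) (degree p) = 0" using p(1) lq dq by simp
    moreover have "degree (p - q) \<le> degree p" using degree_diff_le dq by (metis order_refl)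
    ultimately show False using le ne by (metis le_antisym leading_coeff_0_iff)
  qed
  thus ?thesis by (simp add: q_def R_def)
qed

text \<open>For monic \<open>p\<close> this resultant is the discriminant up to sign. Being a
  determinant in the coefficients, it will be holomorphic in any parameter on which they depend
  holomorphically.\<close>

lemma card_roots_iff_resultant:
  fixes p :: "complex poly"
  assumes p: "lead_coeff p = 1"
  shows "card {x. poly p x = 0} = degree p \<longleftrightarrow> resultant p (pderiv p) \<noteq> 0"
proof -
  have p0: "p \<noteq> 0" using p by auto
  have "resultant p (pderiv p) = 0 \<longleftrightarrow> degree (gcd p (pderiv p)) \<noteq> 0"
    by (rule div_exp_sound_gcd.resultant_0_gcd[OF div_exp_sound_gcd.intro[OF basic_div_exp]])
  also have "\<dots> \<longleftrightarrow> (\<exists>a. poly p a = 0 \<and> poly (pderiv p) a = 0)"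
  proof
    assume "degree (gcd p (pderiv p)) \<noteq> 0"
    then obtain a where "poly (gcd p (pderiv p)) a = 0"
      using fundamental_theorem_of_algebra[of "gcd p (pderiv p)"] by (auto simp: constant_degree)
    thus "\<exists>a. poly p a = 0 \<and> poly (pderiv p) a = 0"
      by (meson dvd_trans gcd_dvd1 gcd_dvd2 poly_eq_0_iff_dvd)
  next
    assume "\<exists>a. poly p a = 0 \<and> poly (pderiv p) a = 0"
    then obtain a where "[:-a, 1:] dvd gcd p (pderiv p)" by (auto simp: poly_eq_0_iff_dvd)
    moreover have "gcd p (pderiv p) \<noteq> 0" using p0 by simp
    ultimately have "degree [:-a, 1:] \<le> degree (gcd p (pderiv p))" by (intro dvd_imp_degree_le)
    thus "degree (gcd p (pderiv p)) \<noteq> 0" by simp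
  qed
  also have "\<dots> \<longleftrightarrow> \<not> rsquarefree p" by (simp add: rsquarefree_roots)
  also have "rsquarefree p \<longleftrightarrow> card {x. poly p x = 0} = degree p"
  proof
    assume "rsquarefree p"
    hence "p = (\<Prod>z|poly p z = 0. [:-z, 1:])"
      using complex_poly_decompose_rsquarefree[of p] p by simp
    hence "degree p = degree (\<Prod>z|poly p z = 0. [:-z, 1:])" by (rule arg_cong)
    also have "\<dots> = card {x. poly p x = 0}" by (subst degree_prod_eq_sum_degree) auto
    finally show "card {x. poly p x = 0} = degree p" by simp
  next
    assume card: "card {x. poly p x = 0} = degree p"
    show "rsquarefree p" unfolding rsquarefree_roots
    proof (intro allI notI)
      fix a assume a: "poly p a = 0 \<and> poly (pderiv p) a = 0"
      define R where "R = {x. poly p x = 0}"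
      define q where "q = (\<Prod>x\<in>R - {a}. [:-x, 1:])"
      have fin: "finite R" unfolding R_def by (rule poly_roots_finite[OF p0])
      have "p = (\<Prod>x\<in>R. [:-x, 1:])" using monic_distinct_roots_prod[OF p card] by (simp add: R_def)
      also have "\<dots> = [:-a, 1:] * q" unfolding q_def using fin a by (intro prod.remove) (auto simp: R_def)
      finally have "poly (pderiv p) a = poly (pderiv ([:-a, 1:] * q)) a" by simp
      also have "\<dots> = poly q a" unfolding pderiv_mult by (simp add: pderiv_pCons)
      also have "\<dots> \<noteq> 0" unfolding q_def using fin by (simp add: poly_prod)
      finally show False using a by blast
    qed
  qed
  finally show ?thesis by blast
qed

text \<open>At \<open>x\<close> near \<open>x0\<close> the polynomial is small at
  \<open>l x0\<close>, so it has a root close by. That root is still inside the disc around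
  \<open>a x\<close>, so uniqueness identifies it with \<open>l x\<close>.\<close>

lemma continuous_on_unique_root:
  fixes p :: "'a::topological_space \<Rightarrow> complex poly"
  assumes p: "\<And>x. x \<in> X \<Longrightarrow> lead_coeff (p x) = 1" "\<And>x. x \<in> X \<Longrightarrow> degree (p x) = Q"
    and cont: "\<And>y. continuous_on X (\<lambda>x. poly (p x) y)" and a: "continuous_on X a"
    and l: "\<And>x. x \<in> X \<Longrightarrow> poly (p x) (l x) = 0" "\<And>x. x \<in> X \<Longrightarrow> dist (a x) (l x) < r"
    and uniq: "\<And>x y. x \<in> X \<Longrightarrow> poly (p x) y = 0 \<Longrightarrow> dist (a x) y < r \<Longrightarrow> y = l x"
  shows "continuous_on X l"
  unfolding continuous_on_def
proof (intro ballI tendstoI)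
  fix x0 and e :: real assume x0: "x0 \<in> X" and e: "e > 0"
  \<comment> \<open>The slack between \<open>l x0\<close> and the rim of its disc is halved: one
    half absorbs the motion of the centre, the other the distance to the new root.\<close>
  define e' where "e' = min e ((r - dist (a x0) (l x0)) / 2)"
  have e': "e' > 0" "e' \<le> e" "2 * e' \<le> r - dist (a x0) (l x0)" using e l(2)[OF x0] by (auto simp: e'_def min_def)
  have "((\<lambda>x. poly (p x) (l x0)) \<longlongrightarrow> 0) (at x0 within X)"
    using cont[of "l x0"] x0 l(1)[OF x0] unfolding continuous_on_def by metis
  from tendstoD[OF this, of "e' ^ Q"] e'(1)
  have ev1: "eventually (\<lambda>x. norm (poly (p x) (l x0)) < e' ^ Q) (at x0 within X)" by simp
  have "(a \<longlongrightarrow> a x0) (at x0 within X)" using a x0 unfolding continuous_on_def by blast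
  from tendstoD[OF this e'(1)] have ev2: "eventually (\<lambda>x. dist (a x) (a x0) < e') (at x0 within X)" .
  have "eventually (\<lambda>x. x \<in> X) (at x0 within X)" by (simp add: eventually_at_filter)
  with ev1 ev2 show "eventually (\<lambda>x. dist (l x) (l x0) < e) (at x0 within X)"
  proof eventually_elim
    case (elim x)
    obtain y where y: "poly (p x) y = 0" "dist (l x0) y < e'"
      using monic_root_near[of "p x" "l x0" e'] p elim e'(1) by auto
    have "dist (a x) y \<le> dist (a x) (a x0) + (dist (a x0) (l x0) + dist (l x0) y)"
      using dist_triangle[of "a x" y "a x0"] dist_triangle[of "a x0" y "l x0"] by linarith
    hence "dist (a x) y < r" using elim(2) y(2) e'(3) by linarith
    hence "y = l x" using uniq elim(3) y(1) by blast
    thus ?case using y(2) e'(2) by (simp add: dist_commute)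
  qed
qed

text \<open>At a zero of \<open>n\<close>, the term of the product rule with the derivative of
  \<open>h\<close> drops out, so continuity of \<open>h\<close> suffices. In the application
  \<open>h\<close> is built from branches known only to be continuous.\<close>

lemma has_derivative_mult_vanishing:
  fixes n h :: "'a::real_normed_vector \<Rightarrow> complex"
  assumes n: "(n has_derivative L) (at z)" "n z = 0" and h: "isCont h z"
  shows "((\<lambda>y. n y * h y) has_derivative (\<lambda>w. L w * h z)) (at z)"
proof -
  have bl: "bounded_linear L" using n(1) by (rule has_derivative_bounded_linear)
  then obtain K where K: "\<And>w. norm (L w) \<le> norm w * K" using bounded_linear.bounded by blast
  have q: "((\<lambda>y. (n y - n z - L (y - z)) /\<^sub>R norm (y - z)) \<longlongrightarrow> 0) (at z)"
    using n(1) unfolding has_derivative_at_within by blast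
  have hl: "(h \<longlongrightarrow> h z) (at z)" using h by (simp add: isCont_def)
  have "((\<lambda>y. ((n y - n z - L (y - z)) /\<^sub>R norm (y - z)) * h y) \<longlongrightarrow> 0 * h z) (at z)"
    by (intro tendsto_mult q hl)
  moreover have "((\<lambda>y. (L (y - z) /\<^sub>R norm (y - z)) * (h y - h z)) \<longlongrightarrow> 0) (at z)"
  proof (rule Lim_null_comparison)
    have "((\<lambda>y. \<bar>K\<bar> * norm (h y - h z)) \<longlongrightarrow> \<bar>K\<bar> * norm (h z - h z)) (at z)" by (intro tendsto_intros hl)
    thus "((\<lambda>y. \<bar>K\<bar> * norm (h y - h z)) \<longlongrightarrow> 0) (at z)" by simp
    show "eventually (\<lambda>y. norm ((L (y - z) /\<^sub>R norm (y - z)) * (h y - h z)) \<le> \<bar>K\<bar> * norm (h y - h z)) (at z)"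
    proof (intro always_eventually allI)
      fix y
      have "norm (L (y - z) /\<^sub>R norm (y - z)) \<le> \<bar>K\<bar>"
      proof (cases "y = z")
        case True thus ?thesis using linear_0[OF bounded_linear.linear[OF bl]] by simp
      next
        case False
        have "norm (L (y - z)) \<le> norm (y - z) * \<bar>K\<bar>" using K[of "y - z"] by (smt (verit) mult_left_mono norm_ge_zero)
        thus ?thesis using False by (simp add: field_simps)
      qed
      thus "norm ((L (y - z) /\<^sub>R norm (y - z)) * (h y - h z)) \<le> \<bar>K\<bar> * norm (h y - h z)"
        unfolding norm_mult by (rule mult_right_mono) simp
    qed
  qed
  ultimately have "((\<lambda>y. ((n y - n z - L (y - z)) /\<^sub>R norm (y - z)) * h y + (L (y - z) /\<^sub>R norm (y - z)) * (h y - h z)) \<longlongrightarrow> 0) (at z)"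
    using tendsto_add by fastforce
  moreover have "((n y - n z - L (y - z)) /\<^sub>R norm (y - z)) * h y + (L (y - z) /\<^sub>R norm (y - z)) * (h y - h z)
      = (n y * h y - n z * h z - L (y - z) * h z) /\<^sub>R norm (y - z)" for y
    using n(2) by (simp add: algebra_simps scaleR_conv_of_real)
  ultimately have "((\<lambda>y. (n y * h y - n z * h z - L (y - z) * h z) /\<^sub>R norm (y - z)) \<longlongrightarrow> 0) (at z)" by simp
  moreover have "bounded_linear (\<lambda>w. L w * h z)" by (intro bounded_linear_intros bl)
  ultimately show ?thesis unfolding has_derivative_at_within by blast
qed

lemma holo_on_det:
  assumes "\<And>z. A z \<in> carrier_mat n n" "\<And>i j. i < n \<Longrightarrow> j < n \<Longrightarrow> holo_on (\<lambda>z. A z $$ (i, j)) U"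
  shows "holo_on (\<lambda>z. det (A z)) U"
  unfolding det_def'[OF assms(1)]
proof (intro holo_on_sum holo_on_mult holo_on_const holo_on_prod assms(2))
  fix \<pi> i assume "\<pi> \<in> {\<pi>. \<pi> permutes {0..<n}}" "i \<in> {0..<n}"
  thus "i < n" "\<pi> i < n" using permutes_in_image[of \<pi> "{0..<n}" i] by auto
qed

lemma holo_on_If: "holo_on f U \<Longrightarrow> holo_on g U \<Longrightarrow> holo_on (\<lambda>z. if c then f z else g z) U"
  by (cases c) auto

section \<open>Zero sets of monic families\<close>

text \<open>As \<open>holo_on\<close> speaks of functions on C^(d+1), a function of \<open>k\<close>
  alone is composed with \<open>fst\<close> and is constant in the last coordinate.\<close>

locale monic_family =
  fixes p :: "complex^'n \<Rightarrow> complex poly" and Q :: nat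
  assumes monic: "lead_coeff (p k) = 1" and deg: "degree (p k) = Q"
    and holo_coeff: "holo_on (\<lambda>z. coeff (p (fst z)) i) UNIV"
begin

definition roots where "roots k = {x. poly (p k) x = 0}"

definition simple_locus where "simple_locus = {k. card (roots k) = Q}"

definition discr :: "(complex^'n) \<times> complex \<Rightarrow> complex" where
  "discr z = resultant (p (fst z)) (pderiv (p (fst z)))"

lemma finite_roots: "finite (roots k)"
  unfolding roots_def using monic[of k] by (intro poly_roots_finite) auto

lemma discr_nonzero_iff: "discr z \<noteq> 0 \<longleftrightarrow> fst z \<in> simple_locus"
  using card_roots_iff_resultant[OF monic[of "fst z"]] by (simp add: discr_def simple_locus_def roots_def deg)

lemma holo_discr: "holo_on discr UNIV"
  unfolding discr_def resultant_def
proof (rule holo_on_det)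
  \<comment> \<open>The constant degree gives the matrix one size for all \<open>z\<close>, with
    coefficients in fixed positions. For \<open>Q = 0\<close> the truncated \<open>Q - 1\<close> is
    still the degree of the derivative.\<close>
  show "sylvester_mat (p (fst z)) (pderiv (p (fst z))) \<in> carrier_mat (Q + (Q - 1)) (Q + (Q - 1))" for z :: "(complex^'n) \<times> complex"
    using sylvester_carrier_mat[of "p (fst z)" "pderiv (p (fst z))"] by (simp add: degree_pderiv deg)
  fix i j assume ij: "i < Q + (Q - 1)" "j < Q + (Q - 1)"
  have "sylvester_mat (p (fst z)) (pderiv (p (fst z))) $$ (i, j) =
      (if i < Q - 1 then if i \<le> j \<and> j - i \<le> Q then coeff (p (fst z)) (Q + i - j) else 0
       else if i - (Q - 1) \<le> j \<and> j \<le> i then of_nat (Suc (i - j)) * coeff (p (fst z)) (Suc (i - j)) else 0)"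
    for z :: "(complex^'n) \<times> complex"
    by (subst sylvester_index_mat) (use ij in \<open>auto simp: degree_pderiv deg coeff_pderiv\<close>)
  note eq = this
  show "holo_on (\<lambda>z. sylvester_mat (p (fst z)) (pderiv (p (fst z))) $$ (i, j)) UNIV"
    unfolding eq by (intro holo_on_If holo_on_const holo_on_mult holo_coeff)
qed

lemma poly_eq_sum_coeff: "poly (p k) x = (\<Sum>i\<le>Q. coeff (p k) i * x ^ i)"
  by (simp add: poly_altdef deg)

lemma holo_poly: "holo_on f U \<Longrightarrow> holo_on (\<lambda>z. poly (p (fst z)) (f z)) U"
  unfolding poly_eq_sum_coeff
  by (intro holo_on_sum holo_on_mult holo_on_power holo_on_subset[OF holo_coeff]) auto

lemma continuous_poly: "continuous_on U (\<lambda>k. poly (p k) x)"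
proof -
  have "continuous_on UNIV (\<lambda>z :: (complex^'n) \<times> complex. poly (p (fst z)) x)"
    by (intro holo_on_imp_continuous_on holo_poly holo_on_const)
  from continuous_on_compose2[OF this, of U "\<lambda>k. (k, 0)"] show ?thesis by (simp add: continuous_intros)
qed

text \<open>Near \<open>x1 = \<Phi> i k1\<close>, the identity \<open>poly (p k) x1 = (\<Prod>j. x1 - \<Phi> j k)\<close> can be solved for \<open>\<Phi> i k\<close>, which gives differentiability from continuity of the branches alone.\<close>

lemma local_branches:
  assumes k0: "k0 \<in> simple_locus"
  obtains e \<Phi> where "e > 0" "\<forall>i\<in>roots k0. holo_on (\<lambda>z. \<Phi> i (fst z)) (ball k0 e \<times> UNIV)"
    "\<forall>k\<in>ball k0 e. inj_on (\<lambda>i. \<Phi> i k) (roots k0)"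
    "\<forall>k\<in>ball k0 e. roots k = (\<lambda>i. \<Phi> i k) ` roots k0"
proof -
  define R where "R = roots k0"
  have R: "finite R" "card R = Q" using k0 finite_roots by (auto simp: R_def simple_locus_def)
  obtain r where r: "r > 0" "\<And>i j. i \<in> R \<Longrightarrow> j \<in> R \<Longrightarrow> i \<noteq> j \<Longrightarrow> 2 * r \<le> dist i j"
  proof -
    define D where "D = (\<lambda>(i, j). dist i j) ` ({(i, j). i \<in> R \<and> j \<in> R \<and> i \<noteq> j})"
    have "finite {(i, j). i \<in> R \<and> j \<in> R \<and> i \<noteq> j}"
      by (rule finite_subset[OF _ finite_cartesian_product[OF R(1) R(1)]]) auto
    \<comment> \<open>The inserted 1 gives \<open>Min\<close> a value when there are fewer than two
      roots and \<open>D\<close> is empty.\<close>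
    hence fD: "finite (insert 1 D)" by (simp add: D_def)
    have pos: "Min (insert 1 D) > 0" using fD by (subst Min_gr_iff) (auto simp: D_def)
    have "Min (insert 1 D) \<le> dist i j" if "i \<in> R" "j \<in> R" "i \<noteq> j" for i j
      using fD that by (intro Min_le) (auto simp: D_def)
    thus ?thesis using that[of "Min (insert 1 D) / 2"] pos by simp
  qed
  have "\<forall>\<^sub>F k in nhds k0. \<forall>i\<in>R. norm (poly (p k) i) < r ^ Q"
  proof (intro eventually_ball_finite ballI R(1))
    fix i assume "i \<in> R"
    hence "poly (p k0) i = 0" by (simp add: R_def roots_def)
    moreover have "isCont (\<lambda>k. poly (p k) i) k0" using continuous_poly[of UNIV i] continuous_on_eq_continuous_at by blast
    ultimately have "((\<lambda>k. poly (p k) i) \<longlongrightarrow> 0) (nhds k0)" by (metis isCont_def tendsto_at_iff_tendsto_nhds)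
    from tendstoD[OF this, of "r ^ Q"] r(1) show "\<forall>\<^sub>F k in nhds k0. norm (poly (p k) i) < r ^ Q" by simp
  qed
  then obtain e where e: "e > 0" "\<And>k i. k \<in> ball k0 e \<Longrightarrow> i \<in> R \<Longrightarrow> norm (poly (p k) i) < r ^ Q"
    unfolding eventually_nhds_metric by (auto simp: dist_commute)
  define G where "G k \<rho> \<longleftrightarrow> (\<forall>i\<in>R. dist i (\<rho> i) < r \<and> (\<forall>x. poly (p k) x = 0 \<and> dist i x < r \<longrightarrow> x = \<rho> i))
    \<and> inj_on \<rho> R \<and> {x. poly (p k) x = 0} = \<rho> ` R" for k \<rho>
  have "\<exists>\<rho>. G k \<rho>" if "k \<in> ball k0 e" for k
    unfolding G_def
  proof (rule monic_roots_in_discs[OF monic R(1), where c = "\<lambda>i. i"])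
    show "card R = degree (p k)" using R(2) by (simp add: deg)
    show "\<exists>x. poly (p k) x = 0 \<and> dist i x < r" if "i \<in> R" for i
      using monic_root_near[OF monic, of k i r] e(2)[OF \<open>k \<in> ball k0 e\<close> that] r(1) by (auto simp: deg)
  qed (use r(2) in auto)
  hence "\<forall>k\<in>ball k0 e. \<exists>\<rho>. G k \<rho>" by blast
  from bchoice[OF this] obtain \<rho> where \<rho>0: "\<forall>k\<in>ball k0 e. G k (\<rho> k)" by (elim exE)
  have \<rho>: "\<And>k i. k \<in> ball k0 e \<Longrightarrow> i \<in> R \<Longrightarrow> dist i (\<rho> k i) < r"
    "\<And>k i x. k \<in> ball k0 e \<Longrightarrow> i \<in> R \<Longrightarrow> poly (p k) x = 0 \<Longrightarrow> dist i x < r \<Longrightarrow> x = \<rho> k i"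
    "\<And>k. k \<in> ball k0 e \<Longrightarrow> inj_on (\<rho> k) R" "\<And>k. k \<in> ball k0 e \<Longrightarrow> {x. poly (p k) x = 0} = \<rho> k ` R"
    using \<rho>0 unfolding G_def by blast+
  define \<Phi> where "\<Phi> i k = \<rho> k i" for i k
  have root: "poly (p k) (\<Phi> i k) = 0" if "k \<in> ball k0 e" "i \<in> R" for i k
    using \<rho>(4)[OF that(1)] that(2) by (auto simp: \<Phi>_def)
  have cont: "continuous_on (ball k0 e) (\<Phi> i)" if i: "i \<in> R" for i
    by (rule continuous_on_unique_root[where p = p and a = "\<lambda>_. i" and r = r and Q = Q])
      (use \<rho> i root monic deg in \<open>auto simp: \<Phi>_def intro: continuous_poly\<close>)
  have split: "poly (p k) x = (\<Prod>i\<in>R. x - \<Phi> i k)" if k: "k \<in> ball k0 e" for k x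
  proof -
    have "card {x. poly (p k) x = 0} = degree (p k)"
      using \<rho>(4)[OF k] card_image[OF \<rho>(3)[OF k]] R(2) by (simp add: deg)
    from monic_distinct_roots_prod[OF monic this]
    have "poly (p k) x = poly (\<Prod>x\<in>\<rho> k ` R. [:-x, 1:]) x" unfolding \<rho>(4)[OF k] by (rule arg_cong)
    also have "\<dots> = (\<Prod>i\<in>R. x - \<Phi> i k)"
      by (simp add: prod.reindex[OF \<rho>(3)[OF k]] poly_prod \<Phi>_def)
    finally show ?thesis .
  qed
  have "holo_on (\<lambda>z. \<Phi> i (fst z)) (ball k0 e \<times> UNIV)" if i: "i \<in> R" for i
    unfolding holo_on_def
  proof
    fix z1 :: "(complex^'n) \<times> complex" assume z1: "z1 \<in> ball k0 e \<times> UNIV"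
    define x1 where "x1 = \<Phi> i (fst z1)"
    have k1: "fst z1 \<in> ball k0 e" using z1 by auto
    define h where "h z = - inverse (\<Prod>j\<in>R - {i}. x1 - \<Phi> j (fst z))" for z :: "(complex^'n) \<times> complex"
    define n where "n z = poly (p (fst z)) x1" for z :: "(complex^'n) \<times> complex"
    have op: "open (ball k0 e \<times> (UNIV :: complex set))" by (intro open_Times) auto
    have c: "continuous_on (ball k0 e \<times> UNIV) (\<lambda>z :: (complex^'n) \<times> complex. \<Prod>j\<in>R - {i}. x1 - \<Phi> j (fst z))"
      by (intro continuous_intros continuous_on_compose2[OF cont]) auto
    have nz: "(\<Prod>j\<in>R - {i}. x1 - \<Phi> j (fst z1)) \<noteq> 0"
      using R(1) \<rho>(3)[OF k1] i by (auto simp: x1_def \<Phi>_def inj_on_def)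
    have ci: "isCont (\<lambda>z :: (complex^'n) \<times> complex. \<Prod>j\<in>R - {i}. x1 - \<Phi> j (fst z)) z1"
      using c op z1 continuous_on_eq_continuous_at by blast
    have hc: "isCont h z1" unfolding h_def by (intro continuous_intros ci nz)
    have "holo_on n UNIV" unfolding n_def by (intro holo_poly holo_on_const)
    then obtain L where L: "(n has_derivative L) (at z1)" "\<forall>c w. L (cscale c w) = c * L w"
      unfolding holo_on_def by blast
    have "n z1 = 0" using root[OF k1 i] by (simp add: n_def x1_def)
    from has_derivative_mult_vanishing[OF L(1) this hc]
    have der: "((\<lambda>z. n z * h z + x1) has_derivative (\<lambda>w. L w * h z1)) (at z1)"
      by (rule has_derivative_add_const)
    have "\<forall>\<^sub>F z in nhds z1. (\<Prod>j\<in>R - {i}. x1 - \<Phi> j (fst z)) \<noteq> 0"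
      using tendsto_imp_eventually_ne[OF ci[unfolded isCont_def] nz] nz by (simp add: eventually_nhds_conv_at)
    moreover have "\<forall>\<^sub>F z in nhds z1. z \<in> ball k0 e \<times> UNIV" using op z1 by (rule eventually_nhds_in_open)
    ultimately have "\<forall>\<^sub>F z in nhds z1. n z * h z + x1 = \<Phi> i (fst z)"
    proof eventually_elim
      case (elim z)
      have "n z = (x1 - \<Phi> i (fst z)) * (\<Prod>j\<in>R - {i}. x1 - \<Phi> j (fst z))"
        unfolding n_def using elim(2) by (subst split) (auto intro!: prod.remove[OF R(1) i])
      thus ?case using elim(1) by (simp add: h_def mult.assoc)
    qed
    then obtain W where W: "open W" "z1 \<in> W" "\<And>z. z \<in> W \<Longrightarrow> n z * h z + x1 = \<Phi> i (fst z)"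
      unfolding eventually_nhds by blast
    have "((\<lambda>z. \<Phi> i (fst z)) has_derivative (\<lambda>w. L w * h z1)) (at z1)"
      by (rule has_derivative_transform_within_open[OF der W(1,2)]) (rule W(3))
    thus "\<exists>L. ((\<lambda>z. \<Phi> i (fst z)) has_derivative L) (at z1) \<and> (\<forall>c w. L (cscale c w) = c * L w)"
      using L(2) by (intro exI[of _ "\<lambda>w. L w * h z1"]) simp
  qed
  thus ?thesis
    by (intro that[OF e(1), of \<Phi>]) (use \<rho>(3,4) in \<open>auto simp: R_def \<Phi>_def roots_def[abs_def]\<close>)
qed

end

lemma holo_on_compose_graph:
  fixes h :: "(complex^'n) \<times> complex \<Rightarrow> complex"
  assumes h: "holo_on h U" and \<phi>: "holo_on (\<lambda>z. \<phi> (fst z)) W"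
    and WU: "\<And>z. z \<in> W \<Longrightarrow> (fst z, \<phi> (fst z)) \<in> U"
  shows "holo_on (\<lambda>z. h (fst z, \<phi> (fst z))) W"
  unfolding holo_on_def
proof
  fix z assume z: "z \<in> W"
  obtain L where L: "((\<lambda>z. \<phi> (fst z)) has_derivative L) (at z)" "\<forall>c w. L (cscale c w) = c * L w"
    using \<phi> z unfolding holo_on_def by blast
  obtain M where M: "(h has_derivative M) (at (fst z, \<phi> (fst z)))" "\<forall>c w. M (cscale c w) = c * M w"
    using h WU[OF z] unfolding holo_on_def by blast
  have "((\<lambda>z. (fst z, \<phi> (fst z))) has_derivative (\<lambda>w. (fst w, L w))) (at z)"
    by (intro has_derivative_Pair L has_derivative_fst has_derivative_ident)
  from has_derivative_compose[OF this M(1)]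
  have "((\<lambda>z. h (fst z, \<phi> (fst z))) has_derivative (\<lambda>w. M (fst w, L w))) (at z)" .
  moreover have "M (fst (cscale c w), L (cscale c w)) = c * M (fst w, L w)" for c w
  proof -
    have "(fst (cscale c w), L (cscale c w)) = cscale c (fst w, L w)"
      using L(2) by (simp add: cscale_def)
    thus ?thesis using M(2) by metis
  qed
  ultimately show "\<exists>L. ((\<lambda>z. h (fst z, \<phi> (fst z))) has_derivative L) (at z) \<and> (\<forall>c w. L (cscale c w) = c * L w)"
    by blast
qed

lemma prod_norm_less_power:
  fixes f :: "'a \<Rightarrow> complex"
  assumes "norm (\<Prod>i\<in>I. f i) < r ^ card I" "finite I" "r > 0"
  obtains i where "i \<in> I" "norm (f i) < r"
proof (rule ccontr)
  assume "\<not> thesis"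
  hence "\<And>i. i \<in> I \<Longrightarrow> r \<le> norm (f i)" using that by force
  hence "(\<Prod>i\<in>I. r) \<le> (\<Prod>i\<in>I. norm (f i))" using assms(3) by (intro prod_mono) auto
  thus False using assms(1) by (simp add: prod_norm)
qed

section \<open>Connected components of the simple part and their closures\<close>

context monic_family
begin

definition simple_part :: "((complex^'n) \<times> complex) set" where
  "simple_part = {z. fst z \<in> simple_locus \<and> snd z \<in> roots (fst z)}"

definition fibre :: "((complex^'n) \<times> complex) set \<Rightarrow> complex^'n \<Rightarrow> complex set" where
  "fibre T k = {x. (k, x) \<in> T}"

lemma simple_locus_connected: "connected simple_locus"
proof -
  have "simple_locus = fst ` {z. discr z \<noteq> 0}"
  proof (intro equalityI subsetI)
    fix k assume "k \<in> simple_locus"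
    hence "(k, 0) \<in> {z. discr z \<noteq> 0}" by (simp add: discr_nonzero_iff)
    thus "k \<in> fst ` {z. discr z \<noteq> 0}" by (rule rev_image_eqI) simp
  qed (auto simp: discr_nonzero_iff)
  thus ?thesis using connected_continuous_image[OF continuous_on_fst[OF continuous_on_id] connected_holo_nonzero[OF holo_discr]] by simp
qed

lemma fibre_subset_roots: "T \<subseteq> simple_part \<Longrightarrow> fibre T k \<subseteq> roots k"
  by (auto simp: fibre_def simple_part_def)

text \<open>The graph of a branch over a ball is connected, so a component of
  \<open>simple_part\<close> contains it entirely or misses it. Locally, \<open>T\<close> thus
  consists of a fixed selection of the branches.\<close>

lemma component_local:
  assumes T: "T \<in> components simple_part" and k0: "k0 \<in> simple_locus"
  obtains e and \<Phi> :: "complex \<Rightarrow> complex^'n \<Rightarrow> complex" and I :: "complex set" where "e > 0" "finite I" "\<forall>i\<in>I. holo_on (\<lambda>z. \<Phi> i (fst z)) (ball k0 e \<times> UNIV)"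
    "\<forall>i\<in>I. continuous_on (ball k0 e) (\<Phi> i)"
    "\<forall>k\<in>ball k0 e. inj_on (\<lambda>i. \<Phi> i k) I"
    "\<forall>k\<in>ball k0 e. fibre T k = (\<lambda>i. \<Phi> i k) ` I"
proof -
  obtain e \<Phi> where "e > 0" "\<forall>i\<in>roots k0. holo_on (\<lambda>z. \<Phi> i (fst z)) (ball k0 e \<times> UNIV)"
    "\<forall>k\<in>ball k0 e. inj_on (\<lambda>i. \<Phi> i k) (roots k0)"
    "\<forall>k\<in>ball k0 e. roots k = (\<lambda>i. \<Phi> i k) ` roots k0"
    by (rule local_branches[OF k0])
  note b = this[rule_format]
  define I where "I = {i \<in> roots k0. (k0, \<Phi> i k0) \<in> T}"
  have cont: "continuous_on (ball k0 e) (\<Phi> i)" if "i \<in> roots k0" for i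
    using continuous_on_compose2[OF holo_on_imp_continuous_on[OF b(2)[OF that]], of "ball k0 e" "\<lambda>k. (k, 0)"]
    by (simp add: continuous_intros image_subset_iff)
  have loc: "k \<in> simple_locus" if "k \<in> ball k0 e" for k
    using card_image[OF b(3)[OF that]] b(4)[OF that] k0 by (simp add: simple_locus_def)
  have graph: "(\<lambda>k. (k, \<Phi> i k)) ` ball k0 e \<subseteq> T" if i: "i \<in> roots k0" and k: "k \<in> ball k0 e" "(k, \<Phi> i k) \<in> T" for i k
  proof (rule components_maximal[OF T])
    show "connected ((\<lambda>k. (k, \<Phi> i k)) ` ball k0 e)"
      by (intro connected_continuous_image continuous_intros cont i) simp
    show "(\<lambda>k. (k, \<Phi> i k)) ` ball k0 e \<subseteq> simple_part"
      using b(4) loc i by (auto simp: simple_part_def)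
    show "T \<inter> (\<lambda>k. (k, \<Phi> i k)) ` ball k0 e \<noteq> {}" using k by blast
  qed
  have "fibre T k = (\<lambda>i. \<Phi> i k) ` I" if k: "k \<in> ball k0 e" for k
  proof
    show "fibre T k \<subseteq> (\<lambda>i. \<Phi> i k) ` I"
    proof
      fix x assume x: "x \<in> fibre T k"
      then obtain i where i: "i \<in> roots k0" "x = \<Phi> i k"
        using fibre_subset_roots[OF in_components_subset[OF T]] b(4)[OF k] by blast
      hence "(k0, \<Phi> i k0) \<in> T" using graph[of i k] k x b(1) by (auto simp: fibre_def)
      thus "x \<in> (\<lambda>i. \<Phi> i k) ` I" using i by (auto simp: I_def)
    qed
    have "\<Phi> i k \<in> fibre T k" if "i \<in> I" for i
    proof -
      have "(\<lambda>k. (k, \<Phi> i k)) ` ball k0 e \<subseteq> T" using graph[of i k0] b(1) that by (simp add: I_def)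
      thus ?thesis using k by (auto simp: fibre_def)
    qed
    thus "(\<lambda>i. \<Phi> i k) ` I \<subseteq> fibre T k" by blast
  qed
  note fib = this
  have I: "I \<subseteq> roots k0" by (auto simp: I_def)
  show ?thesis
  proof (rule that[OF b(1), of I \<Phi>])
    show "finite I" using I finite_roots[of k0] by (rule finite_subset)
    show "\<forall>i\<in>I. holo_on (\<lambda>z. \<Phi> i (fst z)) (ball k0 e \<times> UNIV)" using b(2) I by blast
    show "\<forall>i\<in>I. continuous_on (ball k0 e) (\<Phi> i)" using cont I by blast
    show "\<forall>k\<in>ball k0 e. inj_on (\<lambda>i. \<Phi> i k) I"
    proof
      fix k assume "k \<in> ball k0 e"
      from inj_on_subset[OF b(3)[OF this] I] show "inj_on (\<lambda>i. \<Phi> i k) I" .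
    qed
    show "\<forall>k\<in>ball k0 e. fibre T k = (\<lambda>i. \<Phi> i k) ` I" using fib by blast
  qed
qed

lemma finite_fibre: "T \<subseteq> simple_part \<Longrightarrow> finite (fibre T k)"
  by (rule finite_subset[OF fibre_subset_roots finite_roots])

lemma card_fibre_const:
  assumes T: "T \<in> components simple_part" and k: "k \<in> simple_locus" "k' \<in> simple_locus"
  shows "card (fibre T k) = card (fibre T k')"
proof (rule connected_local_const[OF simple_locus_connected k], rule ballI)
  fix k0 assume k0: "k0 \<in> simple_locus"
  obtain e and \<Phi> :: "complex \<Rightarrow> complex^'n \<Rightarrow> complex" and I :: "complex set" where "e > 0" "finite I" "\<forall>i\<in>I. holo_on (\<lambda>z. \<Phi> i (fst z)) (ball k0 e \<times> UNIV)"
    "\<forall>i\<in>I. continuous_on (ball k0 e) (\<Phi> i)"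
    "\<forall>k\<in>ball k0 e. inj_on (\<lambda>i. \<Phi> i k) I"
    "\<forall>k\<in>ball k0 e. fibre T k = (\<lambda>i. \<Phi> i k) ` I"
    by (rule component_local[OF T k0])
    note c = this[rule_format]
  have "card (fibre T k) = card I" if "k \<in> ball k0 e" for k using c(5,6)[OF that] by (simp add: card_image)
  moreover have "eventually (\<lambda>k. k \<in> ball k0 e) (at k0 within simple_locus)"
    by (rule topological_tendstoD[OF tendsto_ident_at open_ball]) (use c(1) in simp)
  ultimately show "eventually (\<lambda>k. card (fibre T k0) = card (fibre T k)) (at k0 within simple_locus)"
    using c(1) by (auto elim: eventually_mono)
qed

text \<open>The number of sheets is constant over \<open>simple_locus\<close>, and it is positive
  below any point of \<open>T\<close>.\<close>

lemma fibre_nonempty: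
  assumes T: "T \<in> components simple_part" and k: "k \<in> simple_locus"
  shows "fibre T k \<noteq> {}"
proof -
  obtain z where z: "z \<in> T" using in_components_nonempty[OF T] by blast
  have sub: "T \<subseteq> simple_part" by (rule in_components_subset[OF T])
  have "snd z \<in> fibre T (fst z)" using z by (simp add: fibre_def)
  hence "card (fibre T (fst z)) \<noteq> 0" using finite_fibre[OF sub] by (metis card_0_eq empty_iff)
  moreover have "fst z \<in> simple_locus" using z sub by (auto simp: simple_part_def)
  ultimately have "card (fibre T k) \<noteq> 0" using card_fibre_const[OF T _ k] by metis
  thus ?thesis by force
qed

text \<open>A bound of Cauchy type; with continuous coefficients it makes the roots, and hence
  products over sheets, locally bounded.\<close>

lemma norm_root_le:
  assumes "poly (p k) x = 0"
  shows "norm x \<le> 1 + (\<Sum>i<Q. norm (coeff (p k) i))"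
proof (cases "norm x \<le> 1")
  case True
  thus ?thesis by (smt (verit) norm_ge_zero sum_nonneg)
next
  case False
  hence x1: "norm x > 1" by simp
  have Q: "Q > 0"
  proof (rule ccontr)
    assume "\<not> Q > 0"
    hence "p k = 1" using monic[of k] deg[of k] by (metis gr0I monic_degree_0)
    thus False using assms by simp
  qed
  have "poly (p k) x = (\<Sum>i<Q. coeff (p k) i * x ^ i) + x ^ Q"
    using monic[of k] unfolding poly_eq_sum_coeff by (simp add: deg lessThan_Suc_atMost[symmetric])
  hence "x ^ Q = - (\<Sum>i<Q. coeff (p k) i * x ^ i)" using assms by (simp add: add_eq_0_iff)
  hence "norm x ^ Q = norm (\<Sum>i<Q. coeff (p k) i * x ^ i)" by (metis norm_minus_cancel norm_power)
  also have "\<dots> \<le> (\<Sum>i<Q. norm (coeff (p k) i) * norm x ^ (Q - 1))"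
  proof (rule sum_norm_le)
    fix i assume "i \<in> {..<Q}"
    hence "norm x ^ i \<le> norm x ^ (Q - 1)" using x1 by (intro power_increasing) auto
    thus "norm (coeff (p k) i * x ^ i) \<le> norm (coeff (p k) i) * norm x ^ (Q - 1)"
      by (simp add: norm_mult norm_power mult_left_mono)
  qed
  also have "\<dots> = (\<Sum>i<Q. norm (coeff (p k) i)) * norm x ^ (Q - 1)" by (simp add: sum_distrib_right)
  finally have "norm x * norm x ^ (Q - 1) \<le> (\<Sum>i<Q. norm (coeff (p k) i)) * norm x ^ (Q - 1)"
    using Q by (simp add: power_eq_if)
  moreover have "norm x ^ (Q - 1) > 0" using x1 by (intro zero_less_power) linarith
  ultimately have "norm x \<le> (\<Sum>i<Q. norm (coeff (p k) i))" by (rule mult_right_le_imp_le)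
  thus ?thesis by simp
qed

lemma closure_component_analytic:
  assumes T: "T \<in> components simple_part"
  shows "analytic_set (closure T)"
proof -
  have sub: "T \<subseteq> simple_part" by (rule in_components_subset[OF T])
  define f where "f z = (\<Prod>x\<in>fibre T (fst z). snd z - x)" for z
  obtain z1 where z1: "z1 \<in> T" using in_components_nonempty[OF T] by blast
  have d1: "discr z1 \<noteq> 0" using z1 sub by (auto simp: discr_nonzero_iff simple_part_def)
  have fh: "holo_on f {z. discr z \<noteq> 0}"
    unfolding holo_on_def
  proof
    fix z0 assume "z0 \<in> {z. discr z \<noteq> 0}"
    hence k0: "fst z0 \<in> simple_locus" using discr_nonzero_iff by blast
    obtain e and \<Phi> :: "complex \<Rightarrow> complex^'n \<Rightarrow> complex" and I :: "complex set" where "e > 0" "finite I" "\<forall>i\<in>I. holo_on (\<lambda>z. \<Phi> i (fst z)) (ball (fst z0) e \<times> UNIV)"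
    "\<forall>i\<in>I. continuous_on (ball (fst z0) e) (\<Phi> i)"
    "\<forall>k\<in>ball (fst z0) e. inj_on (\<lambda>i. \<Phi> i k) I"
    "\<forall>k\<in>ball (fst z0) e. fibre T k = (\<lambda>i. \<Phi> i k) ` I"
    by (rule component_local[OF T k0])
    note c = this[rule_format]
    have "holo_on (\<lambda>z. \<Prod>i\<in>I. snd z - \<Phi> i (fst z)) (ball (fst z0) e \<times> UNIV)"
      by (intro holo_on_prod holo_on_diff holo_on_snd c(3))
    hence "holo_on f (ball (fst z0) e \<times> UNIV)"
    proof (rule holo_on_cong_open)
      show "open (ball (fst z0) e \<times> (UNIV :: complex set))" by (intro open_Times) auto
      fix z :: "(complex^'n) \<times> complex" assume "z \<in> ball (fst z0) e \<times> UNIV"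
      hence k: "fst z \<in> ball (fst z0) e" by auto
      show "f z = (\<Prod>i\<in>I. snd z - \<Phi> i (fst z))"
        unfolding f_def c(6)[OF k] by (simp add: prod.reindex[OF c(5)[OF k]])
    qed
    moreover have "z0 \<in> ball (fst z0) e \<times> UNIV" using c(1) by (simp add: mem_Times_iff)
    ultimately show "\<exists>L. (f has_derivative L) (at z0) \<and> (\<forall>c w. L (cscale c w) = c * L w)"
      unfolding holo_on_def by blast
  qed
  have bdd: "\<exists>U C. open U \<and> z0 \<in> U \<and> (\<forall>w\<in>U. discr w \<noteq> 0 \<longrightarrow> norm (f w) \<le> C)" for z0
  proof -
    define m where "m w = 1 + norm (snd w) + (1 + (\<Sum>i<Q. norm (coeff (p (fst w)) i)))" for w :: "(complex^'n) \<times> complex"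
    have cm: "continuous_on UNIV m" unfolding m_def
      by (intro continuous_intros holo_on_imp_continuous_on holo_coeff)
    define U where "U = {w. m w < m z0 + 1}"
    have "open U" unfolding U_def by (intro open_Collect_less cm continuous_intros)
    moreover have "norm (f w) \<le> (m z0 + 1) ^ Q" if w: "w \<in> U" "discr w \<noteq> 0" for w
    proof -
      \<comment> \<open>With a base of at least 1 the exponent can be raised from the number of
        sheets to \<open>Q\<close>.\<close>
      have m1: "1 \<le> m z0 + 1" unfolding m_def by (smt (verit) norm_ge_zero sum_nonneg)
      have "norm (f w) = (\<Prod>x\<in>fibre T (fst w). norm (snd w - x))" by (simp add: f_def prod_norm)
      also have "\<dots> \<le> (\<Prod>x\<in>fibre T (fst w). m z0 + 1)"
      proof (intro prod_mono conjI)
        fix x assume "x \<in> fibre T (fst w)"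
        hence "poly (p (fst w)) x = 0" using fibre_subset_roots[OF sub] by (auto simp: roots_def)
        from norm_root_le[OF this] have "norm (snd w - x) \<le> m w"
          using norm_triangle_ineq4[of "snd w" x] by (simp add: m_def)
        thus "norm (snd w - x) \<le> m z0 + 1" using w by (simp add: U_def)
      qed simp
      also have "\<dots> = (m z0 + 1) ^ card (fibre T (fst w))" by simp
      also have "\<dots> \<le> (m z0 + 1) ^ Q"
      proof (intro power_increasing m1)
        show "card (fibre T (fst w)) \<le> Q"
          using card_mono[OF finite_roots fibre_subset_roots[OF sub]] w(2)
          by (metis (mono_tags) discr_nonzero_iff mem_Collect_eq simple_locus_def)
      qed
      finally show ?thesis .
    qed
    moreover have "z0 \<in> U" by (simp add: U_def)
    ultimately show ?thesis by blast
  qed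
  obtain F where F: "holo_on F UNIV" "\<And>z. discr z \<noteq> 0 \<Longrightarrow> F z = f z"
    by (rule riemann_extension[OF holo_discr d1 fh bdd]) (rule that, assumption, simp)
  have "closure T = {z. F z = 0}"
  proof
    have "T \<subseteq> {z. F z = 0}"
    proof
      fix z assume z: "z \<in> T"
      hence "discr z \<noteq> 0" using sub by (auto simp: discr_nonzero_iff simple_part_def)
      moreover have "f z = 0" unfolding f_def using z
        by (intro prod_zero finite_fibre[OF sub]) (auto simp: fibre_def intro: bexI[of _ "snd z"])
      ultimately show "z \<in> {z. F z = 0}" using F(2) by simp
    qed
    thus "closure T \<subseteq> {z. F z = 0}"
      by (intro closure_minimal closed_analytic_set analytic_set_zeros F(1))
    \<comment> \<open>Near a zero of \<open>F\<close> there is a point off the discriminant locus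
      where the product over the \<open>N\<close> sheets is below \<open>(e/2) ^ N\<close>, so some
      sheet is closer than \<open>e/2\<close>.\<close>
    show "{z. F z = 0} \<subseteq> closure T"
    proof
      fix z0 assume "z0 \<in> {z. F z = 0}"
      hence z0: "F z0 = 0" by simp
      define N where "N = card (fibre T (fst z1))"
      show "z0 \<in> closure T"
        unfolding closure_approachable
      proof (intro allI impI)
        fix e :: real assume e: "e > 0"
        define U where "U = ball z0 (e/2) \<inter> {z. norm (F z) < (e/2) ^ N}"
        have "open {z. norm (F z) < (e/2) ^ N}"
          by (intro open_Collect_less continuous_intros holo_on_imp_continuous_on F(1))
        hence "open U" by (simp add: U_def open_Int)
        moreover have "U \<noteq> {}"
        proof -
          have "z0 \<in> U" using e z0 by (simp add: U_def)
          thus ?thesis by blast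
        qed
        ultimately obtain w where w: "w \<in> U" "discr w \<noteq> 0"
          by (rule holo_nonzero_dense[OF holo_discr d1])
        have kw: "fst w \<in> simple_locus" using w(2) discr_nonzero_iff by blast
        have "card (fibre T (fst w)) = N"
          unfolding N_def using card_fibre_const[OF T kw] d1 discr_nonzero_iff by blast
        hence "norm (\<Prod>x\<in>fibre T (fst w). snd w - x) < (e/2) ^ card (fibre T (fst w))"
          using w F(2)[OF w(2)] by (simp add: U_def f_def)
        then obtain x where x: "x \<in> fibre T (fst w)" "norm (snd w - x) < e/2"
          using prod_norm_less_power[OF _ finite_fibre[OF sub], of "\<lambda>x. snd w - x" "fst w" "e/2"] e by auto
        have "dist (fst w, x) z0 \<le> dist (fst w, x) w + dist w z0" by (rule dist_triangle)
        also have "dist (fst w, x) w = norm (snd w - x)"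
          by (cases w) (simp add: dist_Pair_Pair dist_norm norm_minus_commute)
        also have "dist w z0 < e/2" using w(1) by (simp add: U_def dist_commute)
        finally have "dist (fst w, x) z0 < e" using x(2) by simp
        moreover have "(fst w, x) \<in> T" using x(1) by (simp add: fibre_def)
        ultimately show "\<exists>y\<in>T. dist y z0 < e" by blast
      qed
    qed
  qed
  thus ?thesis using analytic_set_zeros[OF F(1)] by simp
qed

text \<open>The property \<open>P\<close> of lying locally in \<open>A\<close> is locally constant
  on the connected set \<open>T\<close>: where \<open>T\<close> is a single graph over a ball, the
  equations of \<open>A\<close> pull back to holomorphic functions on the ball, and vanishing on an
  open part of it spreads to the whole ball.\<close>

lemma component_identity:
  assumes T: "T \<in> components simple_part" and A: "analytic_set A"
    and W: "open W" "z1 \<in> W" "z1 \<in> T" "T \<inter> W \<subseteq> A"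
  shows "T \<subseteq> A"
proof -
  have sub: "T \<subseteq> simple_part" by (rule in_components_subset[OF T])
  define P where "P z \<longleftrightarrow> (\<exists>W. open W \<and> z \<in> W \<and> T \<inter> W \<subseteq> A)" for z
  have "P z1 = P z" if z: "z \<in> T" for z
  proof (rule connected_local_const[OF in_components_connected[OF T] W(3) z], rule ballI)
    fix a assume a: "a \<in> T"
    define k0 where "k0 = fst a"
    have k0: "k0 \<in> simple_locus" using a sub by (auto simp: k0_def simple_part_def)
    obtain e and \<Phi> :: "complex \<Rightarrow> complex^'n \<Rightarrow> complex" and I :: "complex set" where "e > 0" "finite I" "\<forall>i\<in>I. holo_on (\<lambda>z. \<Phi> i (fst z)) (ball k0 e \<times> UNIV)"
    "\<forall>i\<in>I. continuous_on (ball k0 e) (\<Phi> i)"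
    "\<forall>k\<in>ball k0 e. inj_on (\<lambda>i. \<Phi> i k) I"
    "\<forall>k\<in>ball k0 e. fibre T k = (\<lambda>i. \<Phi> i k) ` I"
    by (rule component_local[OF T k0])
    note c = this[rule_format]
    have "snd a \<in> fibre T k0" using a by (simp add: fibre_def k0_def)
    then obtain i where i: "i \<in> I" "snd a = \<Phi> i k0" using c(6)[of k0] c(1) by auto
    have a_eq: "a = (k0, \<Phi> i k0)" using i(2) by (simp add: k0_def prod_eq_iff)
    obtain U F where U: "open U" "a \<in> U" "finite F" "\<forall>f\<in>F. holo_on f U" "A \<inter> U = {w\<in>U. \<forall>f\<in>F. f w = 0}"
      by (rule analytic_setE[OF A, of a])
    define gr where "gr k = (k, \<Phi> i k)" for k
    have cgr: "continuous_on (ball k0 e) gr" unfolding gr_def by (intro continuous_intros c(4) i(1))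
    have "open (ball k0 e \<inter> gr -` U)" by (intro continuous_open_preimage cgr U(1)) simp
    moreover have "k0 \<in> ball k0 e \<inter> gr -` U" using c(1) U(2) a_eq by (simp add: gr_def)
    ultimately obtain e' where e': "e' > 0" "ball k0 e' \<subseteq> ball k0 e \<inter> gr -` U"
      using open_contains_ball by meson
    define N where "N = ball k0 e' \<times> (UNIV :: complex set)"
    have N: "open N" "convex N" unfolding N_def by (auto intro: open_Times convex_Times)
    \<comment> \<open>\<open>sep\<close> vanishes exactly on the other local sheets of
      \<open>T\<close>, so its nonvanishing isolates the sheet through \<open>a\<close>.\<close>
    define sep where "sep z = (\<Prod>j\<in>I - {i}. snd z - \<Phi> j (fst z))" for z :: "(complex^'n) \<times> complex"
    define V where "V = N \<inter> sep -` (- {0})"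
    have csep: "continuous_on N sep" unfolding sep_def N_def
      by (intro continuous_intros continuous_on_compose2[OF c(4)]) (use e'(2) in auto)
    have V: "open V" unfolding V_def by (intro continuous_open_preimage csep N(1)) auto
    have aV: "a \<in> V"
      using c(2) c(5)[of k0] c(1) e'(1) i(1) by (auto simp: V_def N_def sep_def a_eq inj_on_def)
    have TV: "T \<inter> V \<subseteq> gr ` ball k0 e'"
    proof
      fix b assume b: "b \<in> T \<inter> V"
      hence k: "fst b \<in> ball k0 e'" by (auto simp: V_def N_def)
      have "snd b \<in> fibre T (fst b)" using b by (simp add: fibre_def)
      moreover have "fst b \<in> ball k0 e" using k e'(2) by blast
      ultimately obtain j where j: "j \<in> I" "snd b = \<Phi> j (fst b)" using c(6)[of "fst b"] by blast
      have "j = i" using b j c(2) by (auto simp: V_def sep_def)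
      hence "b = gr (fst b)" using j(2) by (simp add: gr_def prod_eq_iff)
      thus "b \<in> gr ` ball k0 e'" using k by blast
    qed
    have grT: "gr k \<in> T" if "k \<in> ball k0 e'" for k
    proof -
      have "k \<in> ball k0 e" using that e'(2) by blast
      hence "\<Phi> i k \<in> fibre T k" using c(6) i(1) by blast
      thus ?thesis by (simp add: gr_def fibre_def)
    qed
    have claim: "gr ` ball k0 e' \<subseteq> A" if b: "b \<in> T \<inter> V" "P b" for b
    proof -
      obtain W' where W': "open W'" "b \<in> W'" "T \<inter> W' \<subseteq> A" using b(2) unfolding P_def by blast
      obtain kb where kb: "kb \<in> ball k0 e'" "b = gr kb" using TV b(1) by blast
      have "f (gr k) = 0" if f: "f \<in> F" and k: "k \<in> ball k0 e'" for f k
      proof -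
        have hol: "holo_on (\<lambda>z. f (fst z, \<Phi> i (fst z))) N"
        proof (rule holo_on_compose_graph[of f U])
          show "holo_on f U" using U(4) f by blast
          show "holo_on (\<lambda>z. \<Phi> i (fst z)) N"
            by (rule holo_on_subset[OF c(3)[OF i(1)]]) (use e'(2) in \<open>auto simp: N_def\<close>)
          show "(fst z, \<Phi> i (fst z)) \<in> U" if "z \<in> N" for z
            using that e'(2) by (auto simp: N_def gr_def)
        qed
        \<comment> \<open>A cylinder over the parameters whose graph point is in \<open>W'\<close>,
          so that the identity theorem on C^(d+1) covers a function of \<open>k\<close>
          alone.\<close>
        define X where "X = (ball k0 e' \<inter> gr -` W') \<times> (UNIV :: complex set)"
        have "open X" unfolding X_def
          by (intro open_Times continuous_open_preimage continuous_on_subset[OF cgr] W'(1)) (use e'(2) in auto)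
        moreover have "X \<noteq> {}" using kb W'(2) by (auto simp: X_def)
        moreover have "X \<subseteq> N" by (auto simp: X_def N_def)
        moreover have "f (fst z, \<Phi> i (fst z)) = 0" if "z \<in> X" for z
        proof -
          have "fst z \<in> ball k0 e'" "gr (fst z) \<in> W'" using that by (auto simp: X_def)
          hence "gr (fst z) \<in> A \<inter> U" using grT W'(3) e'(2) by auto
          thus ?thesis using U(5) f by (simp add: gr_def)
        qed
        ultimately have "f (fst (k, 0::complex), \<Phi> i (fst (k, 0::complex))) = 0"
          by (rule holo_zero_convex[OF hol N]) (use k in \<open>auto simp: N_def\<close>)
        thus ?thesis by (simp add: gr_def)
      qed
      moreover have "gr k \<in> U" if "k \<in> ball k0 e'" for k using that e'(2) by blast
      ultimately show ?thesis using U(5) by blast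
    qed
    have "P a = P b" if b: "b \<in> T \<inter> V" for b
    proof -
      have "P x" if "x \<in> T \<inter> V" "P y" "y \<in> T \<inter> V" for x y
      proof -
        have "T \<inter> V \<subseteq> A" using TV claim[OF that(3,2)] by (rule subset_trans)
        thus ?thesis unfolding P_def using V that(1) by (intro exI[of _ V]) simp
      qed
      thus ?thesis using a aV b by blast
    qed
    note const = this
    have "eventually (\<lambda>b. b \<in> V) (at a within T)" by (rule topological_tendstoD[OF tendsto_ident_at V aV])
    moreover have "eventually (\<lambda>b. b \<in> T) (at a within T)" by (simp add: eventually_at_filter)
    ultimately show "eventually (\<lambda>b. P a = P b) (at a within T)"
    proof eventually_elim
      case (elim b)
      show ?case by (rule const) (use elim in simp)
    qed
  qed
  moreover have "P z1" using W unfolding P_def by blast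
  ultimately show ?thesis unfolding P_def by blast
qed

text \<open>A closed proper subset of the closure cannot contain \<open>T\<close>. So
  \<open>T\<close> has a point off \<open>A1\<close>, near which it lies in \<open>A2\<close>;
  \<open>component_identity\<close> then puts all of \<open>T\<close> into \<open>A2\<close>, a
  contradiction.\<close>

lemma closure_component_irreducible:
  assumes T: "T \<in> components simple_part"
  shows "irreducible_analytic (closure T)"
  unfolding irreducible_analytic_def
proof (intro conjI notI)
  show "analytic_set (closure T)" by (rule closure_component_analytic[OF T])
  show "closure T = {} \<Longrightarrow> False" using in_components_nonempty[OF T] by simp
  assume "\<exists>A1 A2. analytic_set A1 \<and> analytic_set A2 \<and> A1 \<noteq> {} \<and> A2 \<noteq> {} \<and>
            A1 \<subset> closure T \<and> A2 \<subset> closure T \<and> closure T = A1 \<union> A2"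
  then obtain A1 A2 where A: "analytic_set A1" "analytic_set A2" "A1 \<subset> closure T" "A2 \<subset> closure T" "closure T = A1 \<union> A2"
    by (elim exE conjE)
  have ncl: "\<not> T \<subseteq> A" if "analytic_set A" "A \<subset> closure T" for A
    using closure_minimal[OF _ closed_analytic_set[OF that(1)], of T] that(2) by blast
  then obtain z1 where z1: "z1 \<in> T" "z1 \<notin> A1" using A by blast
  have "T \<subseteq> A2"
  proof (rule component_identity[OF T A(2)])
    show "open (- A1)" using closed_analytic_set[OF A(1)] by (rule open_Compl)
    show "T \<inter> - A1 \<subseteq> A2" using A(5) closure_subset[of T] by blast
  qed (use z1 in auto)
  thus False using ncl A by blast
qed

text \<open>Multiple roots are limits of simple ones: arbitrarily near there are parameters with
  nonzero discriminant, and by \<open>monic_root_near\<close> a root over them close to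
  \<open>snd z0\<close>.\<close>

lemma variety_subset_closure:
  assumes ne: "simple_locus \<noteq> {}" and z0: "poly (p (fst z0)) (snd z0) = 0"
  shows "z0 \<in> closure simple_part"
  unfolding closure_approachable
proof (intro allI impI)
  fix e :: real assume e: "e > 0"
  obtain k1 where "k1 \<in> simple_locus" using ne by blast
  hence d1: "discr (k1, 0) \<noteq> 0" by (simp add: discr_nonzero_iff)
  define U where "U = ball z0 (e/2) \<inter> {z. norm (poly (p (fst z)) (snd z0)) < (e/2) ^ Q}"
  have "open {z :: (complex^'n) \<times> complex. norm (poly (p (fst z)) (snd z0)) < (e/2) ^ Q}"
    by (intro open_Collect_less continuous_intros holo_on_imp_continuous_on holo_poly holo_on_const)
  hence "open U" by (simp add: U_def open_Int)
  moreover have "U \<noteq> {}"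
  proof -
    have "z0 \<in> U" using e z0 by (simp add: U_def)
    thus ?thesis by blast
  qed
  ultimately obtain w where w: "w \<in> U" "discr w \<noteq> 0" by (rule holo_nonzero_dense[OF holo_discr d1])
  obtain x where x: "poly (p (fst w)) x = 0" "dist (snd z0) x < e/2"
    using monic_root_near[OF monic, of "fst w" "snd z0" "e/2"] w(1) e by (auto simp: U_def deg)
  have "dist (fst w, x) z0 \<le> dist (fst w, x) (fst w, snd z0) + dist (fst w, snd z0) z0" by (rule dist_triangle)
  also have "dist (fst w, x) (fst w, snd z0) < e/2" using x(2) by (simp add: dist_Pair_Pair dist_commute)
  also have "dist (fst w, snd z0) z0 = dist (fst w) (fst z0)" by (cases z0) (simp add: dist_Pair_Pair)
  also have "dist (fst w) (fst z0) \<le> dist w z0" by (rule dist_fst_le)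
  also have "dist w z0 < e/2" using w(1) by (simp add: U_def dist_commute)
  finally have "dist (fst w, x) z0 < e" by simp
  moreover have "(fst w, x) \<in> simple_part" using x(1) w(2) by (simp add: simple_part_def roots_def discr_nonzero_iff)
  ultimately show "\<exists>y\<in>simple_part. dist y z0 < e" by blast
qed

text \<open>Every component meets the finite fibre over one fixed simple parameter, and distinct
  components are disjoint.\<close>

lemma finite_components:
  assumes "simple_locus \<noteq> {}"
  shows "finite (components simple_part)"
proof -
  obtain k where k: "k \<in> simple_locus" using assms by blast
  define s where "s T = (SOME x. x \<in> fibre T k)" for T
  have s: "s T \<in> fibre T k" if "T \<in> components simple_part" for T
    unfolding s_def using fibre_nonempty[OF that k] by (simp add: some_in_eq)
  have "inj_on s (components simple_part)"
  proof (rule inj_onI)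
    fix T T' assume *: "T \<in> components simple_part" "T' \<in> components simple_part" "s T = s T'"
    hence "(k, s T) \<in> T \<inter> T'" using s[of T] s[of T'] by (simp add: fibre_def)
    thus "T = T'" using components_nonoverlap[OF *(1,2)] by blast
  qed
  moreover have "s ` components simple_part \<subseteq> roots k"
    using s fibre_subset_roots in_components_subset by blast
  ultimately show ?thesis using finite_roots[of k] by (meson finite_imageD finite_subset)
qed

text \<open>The zero set is a finite union of these closures, so the irreducible set \<Omega> lies
  in one of them. That closure is itself irreducible, and maximality of \<Omega> forces
  equality.\<close>

lemma irreducible_component_eq_closure:
  assumes ne: "simple_locus \<noteq> {}" and \<Omega>: "irreducible_component {z. poly (p (fst z)) (snd z) = 0} \<Omega>"
  obtains T where "T \<in> components simple_part" "\<Omega> = closure T"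
proof -
  let ?B = "{z :: (complex^'n) \<times> complex. poly (p (fst z)) (snd z) = 0}"
  have fin: "finite (closure ` components simple_part)" using finite_components[OF ne] by simp
  have "?B \<subseteq> closure (\<Union>(components simple_part))" using variety_subset_closure[OF ne] by auto
  also have "closure (\<Union>(components simple_part)) \<subseteq> \<Union>(closure ` components simple_part)"
  proof (rule closure_minimal)
    show "\<Union>(components simple_part) \<subseteq> \<Union>(closure ` components simple_part)" using closure_subset by fast
    show "closed (\<Union>(closure ` components simple_part))" using fin by (intro closed_Union) auto
  qed
  finally have "\<Omega> \<subseteq> \<Union>(closure ` components simple_part)" using \<Omega> by (auto simp: irreducible_component_def)
  moreover have "irreducible_analytic \<Omega>" using \<Omega> by (simp add: irreducible_component_def)
  ultimately obtain Z where Z: "Z \<in> closure ` components simple_part" "\<Omega> \<subseteq> Z"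
    using irreducible_subset_finite_Union[OF _ fin] closure_component_analytic by blast
  then obtain T where T: "T \<in> components simple_part" "Z = closure T" by blast
  have "closed ?B" by (intro closed_analytic_set analytic_set_zeros holo_poly holo_on_snd)
  moreover have "T \<subseteq> ?B" using in_components_subset[OF T(1)] by (auto simp: simple_part_def roots_def)
  ultimately have "closure T \<subseteq> ?B" by (intro closure_minimal)
  moreover have "\<forall>C. irreducible_analytic C \<and> \<Omega> \<subseteq> C \<and> C \<subseteq> ?B \<longrightarrow> C = \<Omega>"
    using \<Omega> unfolding irreducible_component_def by (elim conjE)
  moreover have "\<Omega> \<subseteq> closure T" using Z(2) T(2) by simp
  ultimately have "closure T = \<Omega>" using closure_component_irreducible[OF T(1)] by meson
  thus ?thesis using that T(1) by blast
qed

end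

section \<open>Periodic families\<close>

definition int_shift :: "int^'n \<Rightarrow> (complex^'n) \<times> complex" where
  "int_shift m = ((\<chi> i. of_int (m $ i)), 0)"

text \<open>\<open>l\<close> follows one root over the real directions from \<open>kst\<close>;
  \<open>l_simple\<close> keeps its graph inside the simple part, and \<open>l_all\<close> says that
  its values at integer points exhaust the fibre over \<open>kst\<close>. Periodicity is stated for
  roots because it is read off the variety.\<close>

locale periodic_monic_family = monic_family p Q for p :: "complex^'n \<Rightarrow> complex poly" and Q +
  fixes kst :: "complex^'n" and l :: "real^'n \<Rightarrow> complex"
  assumes periodic: "poly (p (k + (\<chi> i. of_int (m $ i)))) y = 0 \<longleftrightarrow> poly (p k) y = 0"
    and l_continuous: "continuous_on UNIV l"
    and l_root: "poly (p (kst + (\<chi> i. of_real (x $ i)))) (l x) = 0"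
    and l_simple: "card {y. poly (p (kst + (\<chi> i. of_real (x $ i)))) y = 0} = Q"
    and l_all: "poly (p kst) y = 0 \<Longrightarrow> \<exists>m :: int^'n. y = l (\<chi> i. of_int (m $ i))"
begin

lemma shift_simple_part: "int_shift m + z \<in> simple_part \<longleftrightarrow> z \<in> simple_part"
proof -
  have "fst (int_shift m + z) = fst z + (\<chi> i. of_int (m $ i))" "snd (int_shift m + z) = snd z"
    by (simp_all add: int_shift_def)
  thus ?thesis unfolding simple_part_def simple_locus_def roots_def mem_Collect_eq by (simp only: periodic)
qed

lemma shift_component_subset:
  assumes "z \<in> simple_part"
  shows "(+) (int_shift m) ` connected_component_set simple_part z \<subseteq> connected_component_set simple_part (int_shift m + z)"
proof (rule connected_component_maximal)
  show "int_shift m + z \<in> (+) (int_shift m) ` connected_component_set simple_part z"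
    using assms connected_component_refl by blast
  show "connected ((+) (int_shift m) ` connected_component_set simple_part z)"
    by (intro connected_continuous_image continuous_intros connected_connected_component)
  show "(+) (int_shift m) ` connected_component_set simple_part z \<subseteq> simple_part"
    using connected_component_subset[of simple_part z] shift_simple_part by blast
qed

lemma shift_component:
  assumes "z \<in> simple_part"
  shows "(+) (int_shift m) ` connected_component_set simple_part z = connected_component_set simple_part (int_shift m + z)"
proof
  have inv: "int_shift m + (int_shift (- m) + y) = y" "int_shift (- m) + (int_shift m + y) = y" for y
    by (simp_all add: int_shift_def prod_eq_iff Finite_Cartesian_Product.vec_eq_iff)
  \<comment> \<open>The opposite inclusion is the one already known, applied to the inverse
    translation.\<close>
  have "(+) (int_shift (-m)) ` connected_component_set simple_part (int_shift m + z) \<subseteq> connected_component_set simple_part (int_shift (-m) + (int_shift m + z))"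
    by (rule shift_component_subset) (use assms shift_simple_part in blast)
  hence "int_shift (- m) + y \<in> connected_component_set simple_part z"
    if "y \<in> connected_component_set simple_part (int_shift m + z)" for y
    using that unfolding inv by blast
  thus "connected_component_set simple_part (int_shift m + z) \<subseteq> (+) (int_shift m) ` connected_component_set simple_part z"
    using inv by (metis (no_types, lifting) image_eqI subsetI)
qed (rule shift_component_subset[OF assms])

text \<open>\<open>T\<close> has a point \<open>(kst, y)\<close> with \<open>y = l m\<close>.
  Translating it by \<open>m\<close> gives a point on the graph of \<open>l\<close>, which is
  connected and passes through \<open>(kst, l 0)\<close>. So all components have a translate in
  common.\<close>

lemma component_translate:
  assumes T: "T \<in> components simple_part"
  obtains m where "(+) (int_shift m) ` T = connected_component_set simple_part (kst, l 0)"
proof -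
  define c where "c x = (kst + (\<chi> i. of_real (x $ i)) :: complex^'n, l x)" for x
  have crange: "c x \<in> simple_part" for x
    using l_root[of x] l_simple[of x] by (simp add: simple_part_def simple_locus_def roots_def c_def)
  have "connected (range c)" unfolding c_def
    by (intro connected_continuous_image continuous_intros l_continuous) auto
  hence conn: "connected_component simple_part (c x) (c y)" for x y
    unfolding connected_component_def using crange by blast
  have c0: "c 0 = (kst, l 0)" by (simp add: c_def prod_eq_iff Finite_Cartesian_Product.vec_eq_iff)
  have kst: "kst \<in> simple_locus" using crange[of 0] by (simp add: c0 simple_part_def)
  obtain y where y: "(kst, y) \<in> T" using fibre_nonempty[OF T kst] by (auto simp: fibre_def)
  have yS: "(kst, y) \<in> simple_part" using y in_components_subset[OF T] by blast
  then obtain m :: "int^'n" where m: "y = l (\<chi> i. of_int (m $ i))"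
    using l_all[of y] by (auto simp: simple_part_def roots_def)
  have eq: "int_shift m + (kst, y) = c (\<chi> i. of_int (m $ i))"
    by (simp add: int_shift_def c_def m prod_eq_iff Finite_Cartesian_Product.vec_eq_iff)
  have "T = connected_component_set simple_part (kst, y)"
    using T y by (metis components_iff connected_component_eq)
  hence "(+) (int_shift m) ` T = connected_component_set simple_part (int_shift m + (kst, y))"
    using shift_component[OF yS] by simp
  also have "\<dots> = connected_component_set simple_part (kst, l 0)"
    unfolding eq c0[symmetric] using conn connected_component_eq by (metis mem_Collect_eq)
  finally show ?thesis using that by blast
qed

theorem irreducible_components_translates:
  assumes "irreducible_component {z. poly (p (fst z)) (snd z) = 0} \<Omega>1"
    and "irreducible_component {z. poly (p (fst z)) (snd z) = 0} \<Omega>2"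
  shows "\<exists>m. \<Omega>1 = (+) (int_shift m) ` \<Omega>2"
proof -
  have "kst + (\<chi> i. of_real ((0 :: real^'n) $ i)) \<in> simple_locus"
    unfolding simple_locus_def roots_def by (rule CollectI) (rule l_simple)
  hence ne: "simple_locus \<noteq> {}" by blast
  obtain T1 where T1: "T1 \<in> components simple_part" "\<Omega>1 = closure T1"
    by (rule irreducible_component_eq_closure[OF ne assms(1)])
  obtain T2 where T2: "T2 \<in> components simple_part" "\<Omega>2 = closure T2"
    by (rule irreducible_component_eq_closure[OF ne assms(2)])
  obtain m1 where m1: "(+) (int_shift m1) ` T1 = connected_component_set simple_part (kst, l 0)"
    by (rule component_translate[OF T1(1)])
  obtain m2 where m2: "(+) (int_shift m2) ` T2 = connected_component_set simple_part (kst, l 0)"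
    by (rule component_translate[OF T2(1)])
  have sh: "int_shift (m2 - m1) + z = (- int_shift m1) + (int_shift m2 + z)" for z
    by (simp add: int_shift_def prod_eq_iff Finite_Cartesian_Product.vec_eq_iff)
  have "(+) (int_shift (m2 - m1)) ` T2 = (+) (- int_shift m1) ` ((+) (int_shift m2) ` T2)"
    unfolding image_image sh ..
  also have "\<dots> = (+) (- int_shift m1) ` ((+) (int_shift m1) ` T1)" unfolding m1 m2 ..
  also have "\<dots> = T1" unfolding image_image by simp
  finally have "\<Omega>1 = closure ((+) (int_shift (m2 - m1)) ` T2)" using T1(2) by simp
  also have "\<dots> = (+) (int_shift (m2 - m1)) ` \<Omega>2" unfolding T2(2) by (rule closure_translation)
  finally show ?thesis by blast
qed

end

section \<open>The Floquet matrix\<close>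

text \<open>The expansion shows how the coefficients depend polynomially on the entries: holomorphy
  in a parameter comes from this form, joint continuity from the evaluated form that
  follows.\<close>

lemma char_poly_expansion:
  fixes A :: "complex mat"
  assumes A: "A \<in> carrier_mat n n"
  shows "char_poly A = (\<Sum>\<pi> \<in> {\<pi>. \<pi> permutes {0..<n}}. signof \<pi> *
    (\<Prod>i = 0..<n. if i = \<pi> i then [:- A $$ (i, \<pi> i), 1:] else [:- A $$ (i, \<pi> i):]))"
proof -
  have "char_poly_matrix A $$ (i, j) = (if i = j then [:- A $$ (i, j), 1:] else [:- A $$ (i, j):])"
    if "i < n" "j < n" for i j
    using A that by (auto simp: char_poly_matrix_def)
  hence "(\<Prod>i = 0..<n. char_poly_matrix A $$ (i, \<pi> i)) =
      (\<Prod>i = 0..<n. if i = \<pi> i then [:- A $$ (i, \<pi> i), 1:] else [:- A $$ (i, \<pi> i):])"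
    if "\<pi> permutes {0..<n}" for \<pi>
    using permutes_in_image[OF that] by (intro prod.cong) auto
  thus ?thesis
    unfolding char_poly_def det_def'[OF char_poly_matrix_closed[OF A]] by (intro sum.cong) auto
qed

lemma poly_char_poly_expansion:
  fixes A :: "complex mat"
  assumes A: "A \<in> carrier_mat n n"
  shows "poly (char_poly A) x = (\<Sum>\<pi> \<in> {\<pi>. \<pi> permutes {0..<n}}. signof \<pi> *
    (\<Prod>i = 0..<n. (if i = \<pi> i then x else 0) - A $$ (i, \<pi> i)))"
proof -
  have "poly (if i = \<pi> i then [:- A $$ (i, \<pi> i), 1:] else [:- A $$ (i, \<pi> i):]) x = (if i = \<pi> i then x else 0) - A $$ (i, \<pi> i)"
    for i and \<pi> :: "nat \<Rightarrow> nat" by simp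
  moreover have "poly (signof \<pi>) x = signof \<pi>" for \<pi> :: "nat \<Rightarrow> nat" by (simp add: sign_def)
  ultimately show ?thesis unfolding char_poly_expansion[OF A] by (simp only: poly_sum poly_mult poly_prod)
qed

lemma holo_on_coeff_mult:
  assumes "\<And>i. holo_on (\<lambda>z. coeff (f z) i) U" "\<And>i. holo_on (\<lambda>z. coeff (g z) i) U"
  shows "holo_on (\<lambda>z. coeff (f z * g z) i) U"
  unfolding coeff_mult by (intro holo_on_sum holo_on_mult assms)

lemma holo_on_coeff_prod:
  assumes "\<And>j i. j \<in> I \<Longrightarrow> holo_on (\<lambda>z. coeff (f j z) i) U"
  shows "holo_on (\<lambda>z. coeff (\<Prod>j\<in>I. f j z) i) U"
  using assms
proof (induction I arbitrary: i rule: infinite_finite_induct)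
  case (insert j I)
  have "holo_on (\<lambda>z. coeff (f j z * (\<Prod>j\<in>I. f j z)) i) U"
    by (intro holo_on_coeff_mult insert.IH insert.prems) auto
  thus ?case using insert.hyps by simp
qed (auto intro: holo_on_const)

lemma holo_on_coeff_char_poly:
  fixes A :: "(complex^'n) \<times> complex \<Rightarrow> complex mat"
  assumes A: "\<And>z. A z \<in> carrier_mat n n" and hol: "\<And>i j. i < n \<Longrightarrow> j < n \<Longrightarrow> holo_on (\<lambda>z. A z $$ (i, j)) U"
  shows "holo_on (\<lambda>z. coeff (char_poly (A z)) m) U"
  unfolding char_poly_expansion[OF A] coeff_sum
proof (intro holo_on_sum holo_on_coeff_mult holo_on_coeff_prod holo_on_const)
  fix \<pi> i l assume "\<pi> \<in> {\<pi>. \<pi> permutes {0..<n}}" "i \<in> {0..<n}"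
  hence i: "i < n" "\<pi> i < n" using permutes_in_image[of \<pi> "{0..<n}" i] by auto
  have "holo_on (\<lambda>z. - 1 * A z $$ (i, \<pi> i)) U" by (intro holo_on_mult holo_on_const hol i)
  hence h: "holo_on (\<lambda>z. - A z $$ (i, \<pi> i)) U" by simp
  have "coeff (if i = \<pi> i then [:- A z $$ (i, \<pi> i), 1:] else [:- A z $$ (i, \<pi> i):]) l =
     (if l = 0 then - A z $$ (i, \<pi> i) else if i = \<pi> i \<and> l = 1 then 1 else 0)" for z
    by (auto simp: coeff_pCons split: nat.splits)
  thus "holo_on (\<lambda>z. coeff (if i = \<pi> i then [:- A z $$ (i, \<pi> i), 1:] else [:- A z $$ (i, \<pi> i):]) l) U"
    using holo_on_If[OF h holo_on_const[of "if i = \<pi> i \<and> l = 1 then 1 else 0"], of "l = 0"] by simp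
qed

section \<open>The period cell and its matrices with free hopping weights\<close>

locale periodic_potential =
  fixes q :: "int^'n" and V :: "int^'n \<Rightarrow> complex"
  assumes q_pos: "q $ j > 0" and V_periodic: "V (n + axis j (q $ j)) = V n"
begin

definition red :: "int^'n \<Rightarrow> int^'n" where "red n = (\<chi> j. n $ j mod q $ j)"

definition cell :: "(int^'n) set" where "cell = {n. \<forall>j. 0 \<le> n $ j \<and> n $ j < q $ j}"

definition vol :: nat where "vol = card cell"

text \<open>An arbitrary enumeration of the cell, as matrices are indexed by natural
  numbers.\<close>

definition site :: "nat \<Rightarrow> int^'n" where "site = (SOME h. bij_betw h {0..<vol} cell)"

lemma finite_cell: "finite cell"
proof (rule finite_subset)
  show "cell \<subseteq> vec_lambda ` (PiE UNIV (\<lambda>j. {0..<q $ j}))"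
  proof
    fix n assume "n \<in> cell"
    hence "(\<lambda>j. n $ j) \<in> PiE UNIV (\<lambda>j. {0..<q $ j})" by (auto simp: cell_def)
    thus "n \<in> vec_lambda ` (PiE UNIV (\<lambda>j. {0..<q $ j}))" by (rule rev_image_eqI) simp
  qed
  show "finite (vec_lambda ` (PiE UNIV (\<lambda>j. {0..<q $ j})))" by (intro finite_imageI finite_PiE) auto
qed

lemma bij_site: "bij_betw site {0..<vol} cell"
  unfolding site_def vol_def by (rule someI_ex[OF ex_bij_betw_nat_finite[OF finite_cell]])

lemma red_in_cell: "red n \<in> cell"
  by (simp add: red_def cell_def q_pos)

lemma site_red: obtains s where "s < vol" "site s = red n"
proof -
  have "red n \<in> site ` {0..<vol}" using bij_site red_in_cell[of n] by (simp add: bij_betw_def)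
  thus ?thesis using that by (metis atLeastLessThan_iff imageE)
qed

lemma red_id: "n \<in> cell \<Longrightarrow> red n = n"
  by (simp add: red_def cell_def Finite_Cartesian_Product.vec_eq_iff)

lemma red_periodic: "red (n + axis j (q $ j)) = red n"
  by (simp add: red_def axis_def Finite_Cartesian_Product.vec_eq_iff)

lemma red_add_red: "red (red n + m) = red (n + m)"
  by (simp add: red_def Finite_Cartesian_Product.vec_eq_iff mod_add_left_eq)

lemma red_diff_red: "red (red n - m) = red (n - m)"
  by (simp add: red_def Finite_Cartesian_Product.vec_eq_iff mod_diff_left_eq)

lemma periodic_eq_red:
  assumes per: "\<And>j n. y (n + axis j (q $ j)) = y n"
  shows "y n = y (red n)"
proof -
  have nat: "y (n + axis j (int t * q $ j)) = y n" for j n t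
  proof (induction t)
    case 0
    have "axis j (0::int) = 0" by (simp add: axis_def Finite_Cartesian_Product.vec_eq_iff)
    thus ?case by (simp only: of_nat_0 mult_zero_left add_0_right)
  next
    case (Suc t)
    have "n + axis j (int (Suc t) * q $ j) = (n + axis j (int t * q $ j)) + axis j (q $ j)"
      by (simp add: axis_def Finite_Cartesian_Product.vec_eq_iff algebra_simps)
    thus ?case by (simp only: per Suc)
  qed
  have int: "y (n + axis j (t * q $ j)) = y n" for j n t
  proof (cases "t \<ge> 0")
    case True
    thus ?thesis using nat[of n j "nat t"] by simp
  next
    case False
    have "y (n + axis j (t * q $ j) + axis j (int (nat (- t)) * q $ j)) = y (n + axis j (t * q $ j))" by (rule nat)
    moreover have "n + axis j (t * q $ j) + axis j (int (nat (- t)) * q $ j) = n"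
      using False by (simp add: axis_def Finite_Cartesian_Product.vec_eq_iff)
    ultimately show ?thesis by (simp only:)
  qed
  have "y (m + (\<Sum>j\<in>J. axis j (t j * q $ j))) = y m" if "finite J" for J m and t :: "'n \<Rightarrow> int"
    using that
  proof (induction J arbitrary: m rule: finite_induct)
    case (insert j J)
    have "m + (\<Sum>j\<in>insert j J. axis j (t j * q $ j)) = (m + axis j (t j * q $ j)) + (\<Sum>j\<in>J. axis j (t j * q $ j))"
      using insert.hyps by (simp add: add.assoc)
    thus ?case using insert.IH int by metis
  qed simp
  from this[of UNIV "red n" "\<lambda>j. n $ j div q $ j"]
  have "y (red n + (\<Sum>j\<in>UNIV. axis j (n $ j div q $ j * q $ j))) = y (red n)" by simp
  moreover have "red n + (\<Sum>j\<in>UNIV. axis j (n $ j div q $ j * q $ j)) = n"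
    by (simp add: red_def Finite_Cartesian_Product.vec_eq_iff axis_def if_distrib[of "\<lambda>x. x $ _"] sum.delta mod_div_mult_eq cong: if_cong)
  ultimately show ?thesis by simp
qed

lemma V_red: "V (red n) = V n"
  using periodic_eq_red[of V n] V_periodic by simp

text \<open>Contributions are added, not chosen by cases, because for small \<open>q $ j\<close> the
  two neighbours in direction \<open>j\<close>, or a neighbour and the site itself, may reduce to
  the same point. Forward weights \<open>a\<close>, backward weights \<open>b\<close> and coupling
  \<open>c\<close> are free, so that the Bloch operator, its rescaling and the pure forward hop are
  all instances.\<close>

definition entry :: "complex^'n \<Rightarrow> complex^'n \<Rightarrow> complex \<Rightarrow> int^'n \<Rightarrow> int^'n \<Rightarrow> complex" where
  "entry a b c n n' = (\<Sum>j\<in>UNIV. - (a $ j * of_bool (red (n + axis j 1) = n') + b $ j * of_bool (red (n - axis j 1) = n')))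
     + c * V n * of_bool (n = n')"

definition floquet :: "complex^'n \<Rightarrow> complex^'n \<Rightarrow> complex \<Rightarrow> complex mat" where
  "floquet a b c = Matrix.mat vol vol (\<lambda>(s, t). entry a b c (site s) (site t))"

lemma floquet_carrier: "floquet a b c \<in> carrier_mat vol vol"
  by (simp add: floquet_def)

lemma floquet_index: "s < vol \<Longrightarrow> t < vol \<Longrightarrow> floquet a b c $$ (s, t) = entry a b c (site s) (site t)"
  by (simp add: floquet_def)

definition stencil :: "complex^'n \<Rightarrow> complex^'n \<Rightarrow> complex \<Rightarrow> (int^'n \<Rightarrow> complex) \<Rightarrow> int^'n \<Rightarrow> complex" where
  "stencil a b c y n = (\<Sum>j\<in>UNIV. - (a $ j * y (n + axis j 1) + b $ j * y (n - axis j 1))) + c * V n * y n"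

lemma sum_of_bool_cell: "m \<in> cell \<Longrightarrow> (\<Sum>n'\<in>cell. of_bool (m = n') * f n') = (f m :: complex)"
  using finite_cell by (simp add: of_bool_def if_distrib[of "\<lambda>x. x * _"] sum.delta cong: if_cong)

lemma sum_entry:
  assumes "n \<in> cell"
  shows "(\<Sum>n'\<in>cell. entry a b c n n' * f n') =
    (\<Sum>j\<in>UNIV. - (a $ j * f (red (n + axis j 1)) + b $ j * f (red (n - axis j 1)))) + c * V n * f n"
proof -
  have "(\<Sum>n'\<in>cell. entry a b c n n' * f n') =
     (\<Sum>n'\<in>cell. \<Sum>j\<in>UNIV. - (a $ j * (of_bool (red (n + axis j 1) = n') * f n') + b $ j * (of_bool (red (n - axis j 1) = n') * f n')))
     + (\<Sum>n'\<in>cell. c * V n * (of_bool (n = n') * f n'))"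
    unfolding sum.distrib[symmetric]
    unfolding entry_def distrib_right sum_distrib_right
    by (intro sum.cong arg_cong2[where f = "(+)"] refl) (simp_all add: algebra_simps)
  also have "(\<Sum>n'\<in>cell. c * V n * (of_bool (n = n') * f n')) = c * V n * f n"
    unfolding sum_distrib_left[symmetric] sum_of_bool_cell[OF assms] ..
  also have "(\<Sum>n'\<in>cell. \<Sum>j\<in>UNIV. - (a $ j * (of_bool (red (n + axis j 1) = n') * f n') + b $ j * (of_bool (red (n - axis j 1) = n') * f n')))
     = (\<Sum>j\<in>UNIV. - (a $ j * f (red (n + axis j 1)) + b $ j * f (red (n - axis j 1))))"
    by (subst sum.swap) (simp only: sum_negf sum.distrib sum_distrib_left[symmetric] sum_of_bool_cell[OF red_in_cell])
  finally show ?thesis .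
qed

lemma floquet_mult:
  assumes s: "s < vol"
  shows "vec_index (floquet a b c *\<^sub>v Matrix.vec vol (\<lambda>t. f (site t))) s =
    (\<Sum>j\<in>UNIV. - (a $ j * f (red (site s + axis j 1)) + b $ j * f (red (site s - axis j 1)))) + c * V (site s) * f (site s)"
proof -
  have "vec_index (floquet a b c *\<^sub>v Matrix.vec vol (\<lambda>t. f (site t))) s = (\<Sum>t\<in>{0..<vol}. entry a b c (site s) (site t) * f (site t))"
    using s by (simp add: floquet_def scalar_prod_def)
  also have "\<dots> = (\<Sum>n'\<in>cell. entry a b c (site s) n' * f n')"
    by (rule sum.reindex_bij_betw[OF bij_site])
  finally show ?thesis using sum_entry[of "site s"] bij_betwE[OF bij_site] s by simp
qed

text \<open>Eigenvectors correspond to periodic functions by restriction to the cell and extension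
  along \<open>red\<close>. Later eigenvalue statements can thus be checked on functions on the
  lattice, without touching matrices.\<close>

lemma char_poly_floquet_root:
  "poly (char_poly (floquet a b c)) x = 0 \<longleftrightarrow>
    (\<exists>y. y \<noteq> (\<lambda>_. 0) \<and> (\<forall>j n. y (n + axis j (q $ j)) = y n) \<and> (\<forall>n. stencil a b c y n = x * y n))"
  unfolding eigenvalue_root_char_poly[OF floquet_carrier, symmetric]
proof
  assume "eigenvalue (floquet a b c) x"
  then obtain v where v: "v \<in> carrier_vec vol" "v \<noteq> 0\<^sub>v vol" "floquet a b c *\<^sub>v v = x \<cdot>\<^sub>v v"
    unfolding eigenvalue_def eigenvector_def using floquet_carrier[of a b c] by auto
  define idx where "idx = inv_into {0..<vol} site"
  define f where "f n = vec_index v (idx n)" for n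
  define y where "y n = f (red n)" for n
  have idx: "idx (site s) = s" if "s < vol" for s
    unfolding idx_def using that bij_site by (simp add: bij_betw_def inv_into_f_f)
  have veq: "v = Matrix.vec vol (\<lambda>t. f (site t))"
    using v(1) idx by (intro eq_vecI) (auto simp: f_def)
  obtain s where s: "s < vol" "vec_index v s \<noteq> 0"
    using v(1,2) by (metis carrier_vecD eq_vecI index_zero_vec)
  have "y (site s) \<noteq> 0"
  proof -
    have "site s \<in> cell" using bij_site s(1) by (auto simp: bij_betw_def)
    thus ?thesis using s idx by (simp add: y_def f_def red_id)
  qed
  hence "y \<noteq> (\<lambda>_. 0)" by auto
  moreover have "y (n + axis j (q $ j)) = y n" for j n by (simp add: y_def red_periodic)
  moreover have "stencil a b c y n = x * y n" for n
  proof -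
    obtain s where s: "s < vol" "site s = red n" by (rule site_red)
    have "vec_index (floquet a b c *\<^sub>v v) s = x * vec_index v s" using v s(1) by simp
    also have "vec_index v s = y n" using idx[OF s(1)] s(2) by (simp add: y_def f_def)
    also have "vec_index (floquet a b c *\<^sub>v v) s = stencil a b c y n"
      unfolding veq floquet_mult[OF s(1)] s(2) stencil_def y_def V_red red_add_red red_diff_red ..
    finally show ?thesis .
  qed
  ultimately show "\<exists>y. y \<noteq> (\<lambda>_. 0) \<and> (\<forall>j n. y (n + axis j (q $ j)) = y n) \<and> (\<forall>n. stencil a b c y n = x * y n)"
    by blast
next
  assume "\<exists>y. y \<noteq> (\<lambda>_. 0) \<and> (\<forall>j n. y (n + axis j (q $ j)) = y n) \<and> (\<forall>n. stencil a b c y n = x * y n)"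
  then obtain y where y: "y \<noteq> (\<lambda>_. 0)" "\<And>j n. y (n + axis j (q $ j)) = y n" "\<And>n. stencil a b c y n = x * y n"
    by blast
  have red: "y (red n) = y n" for n using periodic_eq_red[of y n] y(2) by simp
  define v where "v = Matrix.vec vol (\<lambda>t. y (site t))"
  have "floquet a b c *\<^sub>v v = x \<cdot>\<^sub>v v"
  proof (rule eq_vecI)
    fix s assume "s < dim_vec (x \<cdot>\<^sub>v v)"
    hence s: "s < vol" by (simp add: v_def)
    have "vec_index (floquet a b c *\<^sub>v v) s = stencil a b c y (site s)"
      unfolding v_def floquet_mult[OF s] red stencil_def ..
    thus "vec_index (floquet a b c *\<^sub>v v) s = vec_index (x \<cdot>\<^sub>v v) s" using s y(3) by (simp add: v_def)
  qed (simp add: v_def floquet_def)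
  moreover have "v \<noteq> 0\<^sub>v vol"
  proof
    assume v0: "v = 0\<^sub>v vol"
    obtain n where n: "y n \<noteq> 0" using y(1) by auto
    obtain s where s: "s < vol" "site s = red n" by (rule site_red)
    have "vec_index v s = 0" using v0 s by simp
    thus False using n s red by (simp add: v_def)
  qed
  moreover have "v \<in> carrier_vec vol" by (simp add: v_def)
  ultimately show "eigenvalue (floquet a b c) x"
    unfolding eigenvalue_def eigenvector_def using floquet_carrier[of a b c] by auto
qed

text \<open>The gauge factor absorbs the Floquet multipliers, so that only periodic functions remain.\<close>

definition gauge :: "complex^'n \<Rightarrow> int^'n \<Rightarrow> complex" where
  "gauge k n = exp (\<Sum>j\<in>UNIV. 2 * pi * \<i> * k $ j * of_int (n $ j) / of_int (q $ j))"

lemma gauge_shift: "gauge k (n + axis i t) = exp (2 * pi * \<i> * k $ i * of_int t / of_int (q $ i)) * gauge k n"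
proof -
  have "(\<Sum>j\<in>UNIV. 2 * pi * \<i> * k $ j * of_int ((n + axis i t) $ j) / of_int (q $ j)) =
     (\<Sum>j\<in>UNIV. 2 * pi * \<i> * k $ j * of_int (n $ j) / of_int (q $ j)) + (\<Sum>j\<in>UNIV. if j = i then 2 * pi * \<i> * k $ i * of_int t / of_int (q $ i) else 0)"
    unfolding sum.distrib[symmetric] by (intro sum.cong) (auto simp: axis_def algebra_simps add_divide_distrib)
  thus ?thesis by (simp add: gauge_def exp_add mult.commute)
qed

definition wave :: "complex^'n \<Rightarrow> complex^'n" where
  "wave k = (\<chi> j. exp (2 * pi * \<i> * k $ j / of_int (q $ j)))"

definition wave_inv :: "complex^'n \<Rightarrow> complex^'n" where
  "wave_inv k = (\<chi> j. exp (- (2 * pi * \<i> * k $ j / of_int (q $ j))))"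

definition bloch_poly :: "complex^'n \<Rightarrow> complex poly" where
  "bloch_poly k = char_poly (floquet (wave k) (wave_inv k) 1)"

lemma gauge_nonzero: "gauge k n \<noteq> 0"
  by (simp add: gauge_def)

lemma dlap_gauge:
  "- dlap (\<lambda>n. gauge k n * y n) n + V n * (gauge k n * y n) = gauge k n * stencil (wave k) (wave_inv k) 1 y n"
proof -
  have 1: "gauge k (n + axis j 1) = wave k $ j * gauge k n" for j
    using gauge_shift[of k n j 1] by (simp add: wave_def)
  have 2: "gauge k (n - axis j 1) = wave_inv k $ j * gauge k n" for j
  proof -
    have "n + axis j (- 1) = n - axis j 1" by (simp add: axis_def Finite_Cartesian_Product.vec_eq_iff)
    thus ?thesis using gauge_shift[of k n j "- 1"] by (simp add: wave_inv_def)
  qed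
  show ?thesis unfolding dlap_def stencil_def 1 2
    by (simp add: sum_distrib_left sum_negf sum.distrib sum_subtractf algebra_simps)
qed

lemma bloch_variety_eq: "bloch_variety q V = {z. poly (bloch_poly (fst z)) (snd z) = 0}"
proof -
  have "(\<exists>u. u \<noteq> (\<lambda>_. 0) \<and> (\<forall>n. - dlap u n + V n * u n = lam * u n) \<and>
      (\<forall>j n. u (n + axis j (q $ j)) = exp (2 * pi * \<i> * k $ j) * u n)) \<longleftrightarrow> poly (bloch_poly k) lam = 0" for k lam
    unfolding bloch_poly_def char_poly_floquet_root
  proof
    have gq: "gauge k (n + axis j (q $ j)) = exp (2 * pi * \<i> * k $ j) * gauge k n" for j n
      using gauge_shift[of k n j "q $ j"] q_pos[of j] by simp
    {
      assume "\<exists>u. u \<noteq> (\<lambda>_. 0) \<and> (\<forall>n. - dlap u n + V n * u n = lam * u n) \<and>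
        (\<forall>j n. u (n + axis j (q $ j)) = exp (2 * pi * \<i> * k $ j) * u n)"
      then obtain u where u: "u \<noteq> (\<lambda>_. 0)" "\<And>n. - dlap u n + V n * u n = lam * u n"
        "\<And>j n. u (n + axis j (q $ j)) = exp (2 * pi * \<i> * k $ j) * u n" by blast
      define y where "y n = u n / gauge k n" for n
      have uy: "u = (\<lambda>n. gauge k n * y n)" by (simp add: y_def gauge_nonzero)
      have "y \<noteq> (\<lambda>_. 0)" using u(1) unfolding uy by auto
      moreover have "y (n + axis j (q $ j)) = y n" for j n by (simp add: y_def gq u(3))
      moreover have "stencil (wave k) (wave_inv k) 1 y n = lam * y n" for n
        using u(2)[of n] unfolding uy dlap_gauge using gauge_nonzero[of k n] by simp
      ultimately show "\<exists>y. y \<noteq> (\<lambda>_. 0) \<and> (\<forall>j n. y (n + axis j (q $ j)) = y n) \<and> (\<forall>n. stencil (wave k) (wave_inv k) 1 y n = lam * y n)"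
        by blast
    next
      assume "\<exists>y. y \<noteq> (\<lambda>_. 0) \<and> (\<forall>j n. y (n + axis j (q $ j)) = y n) \<and> (\<forall>n. stencil (wave k) (wave_inv k) 1 y n = lam * y n)"
      then obtain y where y: "y \<noteq> (\<lambda>_. 0)" "\<And>j n. y (n + axis j (q $ j)) = y n"
        "\<And>n. stencil (wave k) (wave_inv k) 1 y n = lam * y n" by blast
      have "(\<lambda>n. gauge k n * y n) \<noteq> (\<lambda>_. 0)" using y(1) gauge_nonzero by (auto simp: fun_eq_iff)
      moreover have "- dlap (\<lambda>n. gauge k n * y n) n + V n * (gauge k n * y n) = lam * (gauge k n * y n)" for n
        unfolding dlap_gauge y(3) by simp
      moreover have "gauge k (n + axis j (q $ j)) * y (n + axis j (q $ j)) = exp (2 * pi * \<i> * k $ j) * (gauge k n * y n)" for j n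
        by (simp add: gq y(2))
      ultimately show "\<exists>u. u \<noteq> (\<lambda>_. 0) \<and> (\<forall>n. - dlap u n + V n * u n = lam * u n) \<and>
        (\<forall>j n. u (n + axis j (q $ j)) = exp (2 * pi * \<i> * k $ j) * u n)"
        by (intro exI[of _ "\<lambda>n. gauge k n * y n"]) blast
    }
  qed
  thus ?thesis by (auto simp: bloch_variety_def)
qed

text \<open>The matrix is not periodic in \<open>k\<close>, because \<open>wave\<close> involves
  \<open>k $ j / q $ j\<close>. The defining conditions of the variety are, since they see only
  exp(2 pi i k_j).\<close>

lemma bloch_poly_periodic: "poly (bloch_poly (k + (\<chi> i. of_int (m $ i)))) x = 0 \<longleftrightarrow> poly (bloch_poly k) x = 0"
proof -
  have "exp (2 * pi * \<i> * (k + (\<chi> i. of_int (m $ i))) $ j) = exp (2 * pi * \<i> * k $ j)" for j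
  proof -
    have "2 * pi * \<i> * (k + (\<chi> i. of_int (m $ i))) $ j = 2 * pi * \<i> * k $ j + (2 * of_int (m $ j) * pi) * \<i>"
      by (simp add: algebra_simps)
    thus ?thesis using exp_add exp_integer_2pi[of "of_int (m $ j)"] by (metis Ints_of_int mult.right_neutral)
  qed
  hence "(k + (\<chi> i. of_int (m $ i)), x) \<in> bloch_variety q V \<longleftrightarrow> (k, x) \<in> bloch_variety q V"
    by (simp only: bloch_variety_def mem_Collect_eq split_conv)
  thus ?thesis by (simp add: bloch_variety_eq)
qed

sublocale monic_family bloch_poly vol
proof
  fix k i
  show d: "degree (bloch_poly k) = vol" and "lead_coeff (bloch_poly k) = 1"
    using degree_monic_char_poly[OF floquet_carrier] by (simp_all add: bloch_poly_def)
  have w: "holo_on (\<lambda>z. wave (fst z) $ j) UNIV" "holo_on (\<lambda>z. wave_inv (fst z) $ j) UNIV" for j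
  proof -
    have "(\<lambda>x. exp (2 * pi * \<i> * x / of_int (q $ j))) holomorphic_on UNIV"
      "(\<lambda>x. exp (- (2 * pi * \<i> * x / of_int (q $ j)))) holomorphic_on UNIV"
      using q_pos[of j] by (auto intro!: holomorphic_intros)
    from this[THEN holo_on_compose_entire[OF holo_on_fst_nth]]
    show "holo_on (\<lambda>z. wave (fst z) $ j) UNIV" "holo_on (\<lambda>z. wave_inv (fst z) $ j) UNIV"
      by (simp_all add: wave_def wave_inv_def)
  qed
  show "holo_on (\<lambda>z. coeff (bloch_poly (fst z)) i) UNIV"
    unfolding bloch_poly_def
  proof (rule holo_on_coeff_char_poly[OF floquet_carrier])
    fix s t assume st: "s < vol" "t < vol"
    have "holo_on (\<lambda>z. (\<Sum>j\<in>UNIV. 0 - (wave (fst z) $ j * of_bool (red (site s + axis j 1) = site t) + wave_inv (fst z) $ j * of_bool (red (site s - axis j 1) = site t)))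
     + 1 * V (site s) * of_bool (site s = site t)) UNIV"
      by (intro holo_on_add holo_on_sum holo_on_diff holo_on_mult holo_on_const w)
    thus "holo_on (\<lambda>z. floquet (wave (fst z)) (wave_inv (fst z)) 1 $$ (s, t)) UNIV"
      by (simp add: floquet_index[OF st] entry_def)
  qed
qed

end

section \<open>Eigenvalues far out in the imaginary direction\<close>

text \<open>With weights \<open>K ^ idx j\<close>, the nonzero \<open>d j\<close> of largest index
  outweighs all the others together. The \<open>d j\<close> will be differences of roots of unity up
  to unimodular factors, hence the bound 2 and the gap \<eta>.\<close>

lemma lacunary_coefficients:
  fixes \<eta> :: real
  assumes \<eta>: "\<eta> > 0"
  obtains c :: "'n::finite \<Rightarrow> real" where "\<forall>j. c j > 0"
    "\<forall>d :: 'n \<Rightarrow> complex. (\<forall>j. norm (d j) \<le> 2) \<and> (\<forall>j. d j = 0 \<or> \<eta> \<le> norm (d j)) \<and> (\<exists>j. d j \<noteq> 0)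
      \<longrightarrow> \<eta> / 2 \<le> norm (\<Sum>j\<in>UNIV. of_real (c j) * d j)"
proof -
  obtain idx :: "'n \<Rightarrow> nat" where idx: "inj idx"
    using finite_imp_inj_to_nat_seg[OF finite_class.finite_UNIV] by blast
  define N where "N = real CARD('n)"
  \<comment> \<open>The other terms are at most \<open>2 * c j0 / K\<close> each and
    \<open>N\<close> bounds their number; \<open>4 * N \<le> \<eta> * K\<close> makes their sum at
    most half of the leading term's lower bound \<open>\<eta> * c j0\<close>.\<close>
  define K where "K = 1 + 4 * N / \<eta>"
  have K1: "K \<ge> 1" using \<eta> by (simp add: K_def N_def)
  have KN: "4 * N \<le> \<eta> * K" using \<eta> by (simp add: K_def N_def field_simps)
  define c where "c j = K ^ idx j" for j
  have cpos: "c j > 0" for j using K1 by (simp add: c_def)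
  have "\<eta> / 2 \<le> norm (\<Sum>j\<in>UNIV. of_real (c j) * d j)"
    if d: "\<forall>j. norm (d j) \<le> 2" "\<forall>j. d j = 0 \<or> \<eta> \<le> norm (d j)" "\<exists>j. d j \<noteq> 0" for d :: "'n \<Rightarrow> complex"
  proof -
    define J where "J = {j. d j \<noteq> 0}"
    have "Max (idx ` J) \<in> idx ` J" using d(3) by (intro Max_in) (auto simp: J_def)
    then obtain j0 where j0: "j0 \<in> J" "idx j0 = Max (idx ` J)" by auto
    have le: "idx j \<le> idx j0" if "j \<in> J" for j using that j0(2) by simp
    have small: "norm (of_real (c j) * d j) \<le> 2 * c j0 / K" if j: "j \<in> UNIV - {j0}" for j
    proof (cases "d j = 0")
      case True
      thus ?thesis using cpos[of j0] K1 by simp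
    next
      case False
      hence "idx j \<le> idx j0" using le by (simp add: J_def)
      moreover have "idx j \<noteq> idx j0" using j idx by (auto dest: injD)
      ultimately have "Suc (idx j) \<le> idx j0" by simp
      hence "K ^ Suc (idx j) \<le> K ^ idx j0" using K1 by (intro power_increasing)
      hence "c j \<le> c j0 / K" using K1 by (simp add: c_def field_simps)
      hence "c j * norm (d j) \<le> c j0 / K * 2" using d(1) cpos[of j0] K1 by (intro mult_mono) auto
      thus ?thesis using cpos[of j] by (simp add: norm_mult mult.commute)
    qed
    have "norm (\<Sum>j\<in>UNIV - {j0}. of_real (c j) * d j) \<le> real (card (UNIV - {j0})) * (2 * c j0 / K)"
      by (rule sum_norm_bound) (rule small)
    also have "\<dots> \<le> N * (2 * c j0 / K)"
      using cpos[of j0] K1 by (intro mult_right_mono) (auto simp: N_def card_mono)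
    also have "\<dots> = (4 * N) * (c j0 / (2 * K))" by simp
    also have "\<dots> \<le> (\<eta> * K) * (c j0 / (2 * K))" using KN cpos[of j0] K1 by (intro mult_right_mono) auto
    also have "\<dots> = \<eta> * c j0 / 2" using K1 by simp
    finally have rest: "norm (\<Sum>j\<in>UNIV - {j0}. of_real (c j) * d j) \<le> \<eta> * c j0 / 2" .
    have "(\<Sum>j\<in>UNIV. of_real (c j) * d j) = of_real (c j0) * d j0 + (\<Sum>j\<in>UNIV - {j0}. of_real (c j) * d j)"
      by (rule sum.remove) auto
    moreover have "\<eta> * c j0 \<le> norm (of_real (c j0) * d j0)"
      using d(2) j0(1) cpos[of j0] by (auto simp: norm_mult J_def mult.commute)
    ultimately have "\<eta> * c j0 - \<eta> * c j0 / 2 \<le> norm (\<Sum>j\<in>UNIV. of_real (c j) * d j)"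
      using rest norm_diff_ineq[of "of_real (c j0) * d j0" "\<Sum>j\<in>UNIV - {j0}. of_real (c j) * d j"] by simp
    moreover have "1 \<le> c j0" using K1 by (simp add: c_def)
    hence "\<eta> * 1 \<le> \<eta> * c j0" using \<eta> by (intro mult_left_mono) auto
    ultimately show ?thesis by simp
  qed
  thus ?thesis using that[of c] cpos by blast
qed

definition torus :: "(complex^'n) set" where "torus = {u. \<forall>j. norm (u $ j) = 1}"

lemma compact_torus: "compact torus"
proof -
  have "closed torus" unfolding torus_def
    by (intro closed_Collect_all closed_Collect_eq continuous_intros)
  moreover have "norm u \<le> real CARD('n)" if "u \<in> torus" for u :: "complex^'n"
  proof -
    have "norm u \<le> (\<Sum>j\<in>UNIV. norm (u $ j))" unfolding norm_vec_def by (intro L2_set_le_sum) simp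
    thus ?thesis using that by (simp add: torus_def)
  qed
  hence "bounded torus" unfolding bounded_iff by blast
  ultimately show ?thesis by (simp add: compact_eq_bounded_closed)
qed

section \<open>Roots of unity, separated centres and dominant forward hops\<close>

context periodic_potential
begin

definition zeta :: "'n \<Rightarrow> int \<Rightarrow> complex" where "zeta j t = exp (2 * pi * \<i> * of_int t / of_int (q $ j))"

lemma zeta_inj:
  assumes "0 \<le> t" "t < q $ j" "0 \<le> t'" "t' < q $ j" "zeta j t = zeta j t'"
  shows "t = t'"
proof -
  have q0: "(of_int (q $ j) :: complex) \<noteq> 0" using q_pos[of j] by simp
  obtain n :: int where n: "2 * pi * \<i> * of_int t / of_int (q $ j) = 2 * pi * \<i> * of_int t' / of_int (q $ j) + (of_int (2 * n) * pi) * \<i>"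
    using assms(5) unfolding zeta_def exp_eq by blast
  hence "(2 * pi * \<i>) * of_int t = (2 * pi * \<i>) * (of_int t' + of_int n * of_int (q $ j))"
    using q0 by (simp add: field_simps)
  hence "(of_int t :: complex) = of_int t' + of_int n * of_int (q $ j)" by simp
  hence "(of_int t :: complex) = of_int (t' + n * q $ j)" by simp
  hence "t = t' + n * q $ j" by (simp only: of_int_eq_iff)
  hence "t mod q $ j = t' mod q $ j" by simp
  thus ?thesis using assms(1-4) by simp
qed

lemma zeta_separated:
  obtains \<eta> where "\<eta> > 0"
    "\<forall>j t t'. 0 \<le> t \<and> t < q $ j \<and> 0 \<le> t' \<and> t' < q $ j \<and> t \<noteq> t' \<longrightarrow> \<eta> \<le> norm (zeta j t - zeta j t')"
proof -
  define X where "X = {(j, t, t'). 0 \<le> t \<and> t < q $ j \<and> 0 \<le> t' \<and> t' < q $ j \<and> t \<noteq> t'}"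
  define D where "D = insert 1 ((\<lambda>(j, t, t'). norm (zeta j t - zeta j t')) ` X)"
  have "X \<subseteq> (SIGMA j:UNIV. {0..<q $ j} \<times> {0..<q $ j})" by (auto simp: X_def)
  hence "finite X" by (rule finite_subset) auto
  hence fin: "finite D" by (simp add: D_def)
  have "Min D > 0" using fin zeta_inj by (subst Min_gr_iff) (auto simp: D_def X_def)
  moreover have "Min D \<le> norm (zeta j t - zeta j t')"
    if "0 \<le> t" "t < q $ j" "0 \<le> t'" "t' < q $ j" "t \<noteq> t'" for j t t'
    using fin that by (intro Min_le) (auto simp: D_def X_def intro!: image_eqI[where x = "(j, t, t')"])
  ultimately show ?thesis using that by blast
qed

lemma continuous_on_poly_floquet:
  assumes "\<And>j. continuous_on S (\<lambda>x. a x $ j)" "\<And>j. continuous_on S (\<lambda>x. b x $ j)"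
    "continuous_on S c" "continuous_on S e"
  shows "continuous_on S (\<lambda>x. poly (char_poly (floquet (a x) (b x) (c x))) (e x))"
  unfolding poly_char_poly_expansion[OF floquet_carrier]
proof (intro continuous_on_sum continuous_on_mult continuous_on_prod continuous_on_const continuous_on_diff)
  fix \<pi> i assume "\<pi> \<in> {\<pi>. \<pi> permutes {0..<vol}}" "i \<in> {0..<vol}"
  hence i: "i < vol" "\<pi> i < vol" using permutes_in_image[of \<pi> "{0..<vol}" i] by auto
  show "continuous_on S (\<lambda>x. if i = \<pi> i then e x else 0)" by (cases "i = \<pi> i") (auto intro: assms)
  show "continuous_on S (\<lambda>x. floquet (a x) (b x) (c x) $$ (i, \<pi> i))"
    unfolding floquet_index[OF i] entry_def by (intro continuous_intros assms)
qed

lemma floquet_scale_root: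
  assumes e: "e \<noteq> 0"
  shows "poly (char_poly (floquet (\<chi> j. e * a $ j) (\<chi> j. e * b $ j) (e * c))) (e * x) = 0 \<longleftrightarrow> poly (char_poly (floquet a b c)) x = 0"
proof -
  have "stencil (\<chi> j. e * a $ j) (\<chi> j. e * b $ j) (e * c) y n = e * stencil a b c y n" for y n
    by (simp add: stencil_def sum_distrib_left algebra_simps)
  thus ?thesis unfolding char_poly_floquet_root using e by simp
qed

text \<open>The plane wave \<open>gauge k\<close> with integral \<open>k\<close> is periodic, and a
  forward hop in direction \<open>j\<close> multiplies it by \<open>zeta j (m $ j)\<close>.\<close>

lemma floquet_free_root:
  "poly (char_poly (floquet a 0 0)) (- (\<Sum>j\<in>UNIV. a $ j * zeta j (m $ j))) = 0"
  unfolding char_poly_floquet_root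
proof (intro exI conjI allI)
  define k :: "complex^'n" where "k = (\<chi> j. of_int (m $ j))"
  show "gauge k \<noteq> (\<lambda>_. 0)" using gauge_nonzero by metis
  show "gauge k (n + axis j (q $ j)) = gauge k n" for j n
  proof -
    have "gauge k (n + axis j (q $ j)) = exp ((2 * of_int (m $ j) * pi) * \<i>) * gauge k n"
      using gauge_shift[of k n j "q $ j"] q_pos[of j] by (simp add: k_def mult.commute mult.left_commute)
    also have "exp ((2 * of_int (m $ j) * pi) * \<i>) = 1" using exp_integer_2pi[of "of_int (m $ j)"] by simp
    finally show ?thesis by simp
  qed
  have "gauge k (n + axis j 1) = zeta j (m $ j) * gauge k n" for j n
    using gauge_shift[of k n j 1] by (simp add: zeta_def k_def)
  thus "stencil a 0 0 (gauge k) n = - (\<Sum>j\<in>UNIV. a $ j * zeta j (m $ j)) * gauge k n" for n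
    by (simp add: stencil_def sum_negf sum_distrib_right mult.assoc)
qed

text \<open>The eigenvalue of the pure forward hop with weights \<open>c j * u $ j\<close> on the
  plane wave numbered by \<open>m\<close>; for \<open>u $ j\<close> equal to e^(2 pi i x_j / q_j) it
  is \<open>a (x + m)\<close> in the overview.\<close>

definition centre :: "('n \<Rightarrow> real) \<Rightarrow> complex^'n \<Rightarrow> int^'n \<Rightarrow> complex" where
  "centre c u m = - (\<Sum>j\<in>UNIV. of_real (c j) * u $ j * zeta j (m $ j))"

text \<open>The Floquet matrix times \<epsilon>, when the wave factors are
  \<open>c j * u $ j / \<epsilon>\<close>. The backward weights, being \<epsilon> times their
  inverses, become of order \<open>\<epsilon>\<^sup>2\<close>, and everything extends continuously
  to \<epsilon> = 0.\<close>

definition scaled :: "('n \<Rightarrow> real) \<Rightarrow> real \<Rightarrow> complex^'n \<Rightarrow> complex poly" where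
  "scaled c \<epsilon> u = char_poly (floquet (\<chi> j. of_real (c j) * u $ j) (\<chi> j. of_real (\<epsilon>\<^sup>2) / (of_real (c j) * u $ j)) (of_real \<epsilon>))"

lemma scaled_monic: "lead_coeff (scaled c \<epsilon> u) = 1" "degree (scaled c \<epsilon> u) = vol"
  using degree_monic_char_poly[OF floquet_carrier] by (simp_all add: scaled_def)

text \<open>Factors in \<open>u\<close> have modulus 1, so they change neither the bound 2 nor the
  gap \<eta> of the differences of roots of unity, and the lacunary estimate holds uniformly over
  the torus.\<close>

lemma centre_separated:
  assumes \<eta>: "\<forall>j t t'. 0 \<le> t \<and> t < q $ j \<and> 0 \<le> t' \<and> t' < q $ j \<and> t \<noteq> t' \<longrightarrow> \<eta> \<le> norm (zeta j t - zeta j t')"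
    and c: "\<forall>d :: 'n \<Rightarrow> complex. (\<forall>j. norm (d j) \<le> 2) \<and> (\<forall>j. d j = 0 \<or> \<eta> \<le> norm (d j)) \<and> (\<exists>j. d j \<noteq> 0)
      \<longrightarrow> \<eta> / 2 \<le> norm (\<Sum>j\<in>UNIV. of_real (c j) * d j)" and "\<eta> > 0"
    and u: "u \<in> torus" and m: "m \<in> cell" "m' \<in> cell" "m \<noteq> m'"
  shows "\<eta> / 2 \<le> dist (centre c u m) (centre c u m')"
proof -
  define d where "d j = u $ j * (zeta j (m $ j) - zeta j (m' $ j))" for j
  have nd: "norm (d j) = norm (zeta j (m $ j) - zeta j (m' $ j))" for j
    using u by (simp add: d_def norm_mult torus_def)
  have nz: "norm (zeta j t) = 1" for j t by (simp add: zeta_def norm_exp_eq_Re)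
  have "norm (d j) \<le> 2" for j
    unfolding nd using norm_triangle_ineq4[of "zeta j (m $ j)" "zeta j (m' $ j)"] by (simp add: nz)
  moreover have sep: "\<eta> \<le> norm (d j)" if "m $ j \<noteq> m' $ j" for j
    unfolding nd using \<eta> m that by (simp add: cell_def)
  moreover have "d j = 0 \<or> \<eta> \<le> norm (d j)" for j using sep[of j] by (cases "m $ j = m' $ j") (auto simp: d_def)
  moreover have "\<exists>j. d j \<noteq> 0"
  proof -
    obtain j where "m $ j \<noteq> m' $ j" using m(3) by (auto simp: Finite_Cartesian_Product.vec_eq_iff)
    hence "norm (d j) > 0" using sep[of j] \<open>\<eta> > 0\<close> by linarith
    thus ?thesis by auto
  qed
  ultimately have "\<eta> / 2 \<le> norm (\<Sum>j\<in>UNIV. of_real (c j) * d j)" using c by blast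
  also have "(\<Sum>j\<in>UNIV. of_real (c j) * d j) = centre c u m' - centre c u m"
    by (simp add: centre_def d_def sum_subtractf algebra_simps)
  finally show ?thesis by (simp add: dist_norm norm_minus_commute)
qed

text \<open>At \<open>\<epsilon> = 0\<close> the potential and the backward hops disappear, so every centre is an exact root; the torus is compact, so they are uniformly almost roots for small \<open>\<epsilon>\<close>.\<close>

lemma scaled_small_at_centres:
  assumes c: "\<forall>j. c j > 0" and r: "r > 0"
  obtains \<epsilon> where "\<epsilon> > 0" "\<forall>u\<in>torus. \<forall>m\<in>cell. norm (poly (scaled c \<epsilon> u) (centre c u m)) < r"
proof -
  have "\<forall>m\<in>cell. \<forall>\<^sub>F \<epsilon> in at_right 0. \<forall>u\<in>torus. norm (poly (scaled c \<epsilon> u) (centre c u m)) < r"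
  proof
    fix m assume "m \<in> cell"
    define f where "f z = poly (scaled c (fst z) (snd z)) (centre c (snd z) m)" for z
    have "continuous_on ({0..1} \<times> torus) f"
      unfolding f_def scaled_def centre_def
    proof (rule continuous_on_poly_floquet)
      show "continuous_on ({0..1} \<times> torus) (\<lambda>x. (\<chi> j. of_real ((fst x)\<^sup>2) / (of_real (c j) * snd x $ j)) $ j)" for j
      proof -
        have "of_real (c j) * snd x $ j \<noteq> 0" if "x \<in> {0..1} \<times> torus" for x :: "real \<times> (complex^'n)"
          using that c[rule_format, of j] by (auto simp: torus_def dest!: spec[of _ j])
        hence "continuous_on ({0..1} \<times> torus) (\<lambda>x :: real \<times> (complex^'n). of_real ((fst x)\<^sup>2) / (of_real (c j) * snd x $ j))"
          by (intro continuous_intros) blast+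
        thus ?thesis by simp
      qed
    qed (auto intro!: continuous_intros)
    hence "uniformly_continuous_on ({0..1} \<times> torus) f"
      by (intro compact_uniformly_continuous compact_Times compact_torus) auto
    from this[unfolded uniformly_continuous_on_def, rule_format, OF r]
    obtain \<delta> where \<delta>: "\<delta> > 0" "\<forall>x\<in>{0..1} \<times> torus. \<forall>x'\<in>{0..1} \<times> torus. dist x' x < \<delta> \<longrightarrow> dist (f x') (f x) < r"
      by blast
    have zero: "f (0, u) = 0" for u
    proof -
      have "(\<chi> j. of_real ((0::real)\<^sup>2) / (of_real (c j) * u $ j)) = (0 :: complex^'n)"
        by (simp add: Finite_Cartesian_Product.vec_eq_iff)
      thus ?thesis using floquet_free_root[of "\<chi> j. of_real (c j) * u $ j" m]
        by (simp add: f_def scaled_def centre_def)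
    qed
    have "norm (poly (scaled c \<epsilon> u) (centre c u m)) < r" if "\<epsilon> > 0" "\<epsilon> < min 1 \<delta>" "u \<in> torus" for \<epsilon> u
    proof -
      have "dist (f (\<epsilon>, u)) (f (0, u)) < r"
        by (rule \<delta>(2)[rule_format]) (use that in \<open>auto simp: dist_Pair_Pair\<close>)
      thus ?thesis unfolding zero by (simp add: f_def)
    qed
    moreover have "\<forall>\<^sub>F \<epsilon> in at_right 0. \<epsilon> \<in> {0<..<min 1 \<delta>}"
      using \<delta>(1) by (intro eventually_at_right_real) simp
    ultimately show "\<forall>\<^sub>F \<epsilon> in at_right 0. \<forall>u\<in>torus. norm (poly (scaled c \<epsilon> u) (centre c u m)) < r"
      by (auto elim!: eventually_mono)
  qed
  hence "\<forall>\<^sub>F \<epsilon> in at_right 0. \<forall>m\<in>cell. \<forall>u\<in>torus. norm (poly (scaled c \<epsilon> u) (centre c u m)) < r"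
    by (intro eventually_ball_finite finite_cell)
  moreover have "\<forall>\<^sub>F \<epsilon> :: real in at_right 0. \<epsilon> > 0" by (simp add: eventually_at_right_less)
  ultimately have "\<forall>\<^sub>F \<epsilon> :: real in at_right 0. \<epsilon> > 0 \<and> (\<forall>m\<in>cell. \<forall>u\<in>torus. norm (poly (scaled c \<epsilon> u) (centre c u m)) < r)"
    by eventually_elim simp
  from eventually_happens[OF this] show ?thesis using that by auto
qed

lemma bloch_family:
  "\<exists>kst l. periodic_monic_family bloch_poly vol kst l"
proof -
  obtain \<eta> where \<eta>: "\<eta> > 0"
    "\<forall>j t t'. 0 \<le> t \<and> t < q $ j \<and> 0 \<le> t' \<and> t' < q $ j \<and> t \<noteq> t' \<longrightarrow> \<eta> \<le> norm (zeta j t - zeta j t')"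
    by (rule zeta_separated)
  obtain c :: "'n \<Rightarrow> real" where c: "\<forall>j. c j > 0"
    "\<forall>d :: 'n \<Rightarrow> complex. (\<forall>j. norm (d j) \<le> 2) \<and> (\<forall>j. d j = 0 \<or> \<eta> \<le> norm (d j)) \<and> (\<exists>j. d j \<noteq> 0)
      \<longrightarrow> \<eta> / 2 \<le> norm (\<Sum>j\<in>UNIV. of_real (c j) * d j)"
    by (rule lacunary_coefficients[OF \<eta>(1)])
  \<comment> \<open>The centres are at least \<open>\<eta> / 2\<close> apart, which is the
    \<open>2 * r\<close> needed for disjoint discs.\<close>
  define r where "r = \<eta> / 4"
  have r: "r > 0" using \<eta>(1) by (simp add: r_def)
  obtain \<epsilon> where \<epsilon>: "\<epsilon> > 0" "\<forall>u\<in>torus. \<forall>m\<in>cell. norm (poly (scaled c \<epsilon> u) (centre c u m)) < r ^ vol"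
    using scaled_small_at_centres[OF c(1), of "r ^ vol"] r by auto
  define u :: "real^'n \<Rightarrow> complex^'n" where "u x = (\<chi> j. exp (2 * pi * \<i> * of_real (x $ j) / of_int (q $ j)))" for x
  \<comment> \<open>Solves \<open>wave kst $ j = c j / \<epsilon>\<close>.\<close>
  define kst :: "complex^'n" where "kst = (\<chi> j. of_int (q $ j) * of_real (ln (c j / \<epsilon>)) / (2 * pi * \<i>))"
  define P where "P x = scaled c \<epsilon> (u x)" for x
  have torus: "u x \<in> torus" for x by (simp add: u_def torus_def norm_exp_eq_Re)
  define G where "G x \<rho> \<longleftrightarrow> (\<forall>m\<in>cell. dist (centre c (u x) m) (\<rho> m) < r \<and>
      (\<forall>y. poly (P x) y = 0 \<and> dist (centre c (u x) m) y < r \<longrightarrow> y = \<rho> m)) \<and> inj_on \<rho> cell \<and> {y. poly (P x) y = 0} = \<rho> ` cell" for x \<rho>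
  have "\<exists>\<rho>. G x \<rho>" for x
    unfolding G_def
  proof (rule monic_roots_in_discs[OF _ finite_cell])
    show "lead_coeff (P x) = 1" unfolding P_def by (rule scaled_monic)
    show "card cell = degree (P x)" unfolding P_def scaled_monic vol_def ..
    show "2 * r \<le> dist (centre c (u x) m) (centre c (u x) m')" if "m \<in> cell" "m' \<in> cell" "m \<noteq> m'" for m m'
      using centre_separated[OF \<eta>(2) c(2) \<eta>(1) torus that] by (simp add: r_def)
    show "\<exists>y. poly (P x) y = 0 \<and> dist (centre c (u x) m) y < r" if m: "m \<in> cell" for m
    proof -
      have "norm (poly (P x) (centre c (u x) m)) < r ^ degree (P x)"
        using \<epsilon>(2) torus m by (simp add: P_def scaled_monic)
      thus ?thesis using monic_root_near[of "P x" "centre c (u x) m" r] r scaled_monic(1) by (metis P_def)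
    qed
  qed
  then obtain \<rho> where \<rho>0: "\<And>x. G x (\<rho> x)" by metis
  have \<rho>: "\<And>x m. m \<in> cell \<Longrightarrow> dist (centre c (u x) m) (\<rho> x m) < r"
    "\<And>x m y. m \<in> cell \<Longrightarrow> poly (P x) y = 0 \<Longrightarrow> dist (centre c (u x) m) y < r \<Longrightarrow> y = \<rho> x m"
    "\<And>x. inj_on (\<rho> x) cell" "\<And>x. {y. poly (P x) y = 0} = \<rho> x ` cell"
    using \<rho>0 unfolding G_def by blast+
  have cell0: "0 \<in> cell" by (simp add: cell_def q_pos)
  have root: "poly (P x) (\<rho> x m) = 0" if "m \<in> cell" for x m using \<rho>(4)[of x] that by blast
  \<comment> \<open>By the choice of \<open>kst\<close>, \<open>P x\<close> belongs to \<epsilon>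
    times the Floquet matrix over \<open>kst + x\<close>.\<close>
  have scale: "poly (P x) (of_real \<epsilon> * y) = 0 \<longleftrightarrow> poly (bloch_poly (kst + (\<chi> i. of_real (x $ i)))) y = 0" for x y
  proof -
    define k where "k = kst + (\<chi> i. of_real (x $ i))"
    have w: "of_real (c j) * u x $ j = of_real \<epsilon> * wave k $ j" for j
    proof -
      have "2 * pi * \<i> * k $ j / of_int (q $ j) = of_real (ln (c j / \<epsilon>)) + 2 * pi * \<i> * of_real (x $ j) / of_int (q $ j)"
      proof -
        have "t * (Q * L / t + X) / Q = L + t * X / Q" if "t \<noteq> 0" "Q \<noteq> 0" for t Q L X :: complex
          using that by (simp add: distrib_left add_divide_distrib)
        from this[of "2 * pi * \<i>" "of_int (q $ j)" "of_real (ln (c j / \<epsilon>))" "of_real (x $ j)"]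
        show ?thesis using q_pos[of j] by (simp add: k_def kst_def)
      qed
      hence "wave k $ j = exp (of_real (ln (c j / \<epsilon>))) * u x $ j" by (simp add: wave_def u_def exp_add)
      also have "exp (of_real (ln (c j / \<epsilon>))) = (of_real (c j / \<epsilon>) :: complex)"
        using c(1) \<epsilon>(1) by (simp add: exp_of_real)
      finally show ?thesis using \<epsilon>(1) by simp
    qed
    have "of_real (\<epsilon>\<^sup>2) / (of_real (c j) * u x $ j) = of_real \<epsilon> * wave_inv k $ j" for j
    proof -
      have "wave_inv k $ j = inverse (wave k $ j)" by (simp add: wave_def wave_inv_def exp_minus)
      moreover have "wave k $ j \<noteq> 0" by (simp add: wave_def)
      ultimately show ?thesis unfolding w using \<epsilon>(1) by (simp add: power2_eq_square divide_inverse)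
    qed
    hence "P x = char_poly (floquet (\<chi> j. of_real \<epsilon> * wave k $ j) (\<chi> j. of_real \<epsilon> * wave_inv k $ j) (of_real \<epsilon> * 1))"
      unfolding P_def scaled_def w by simp
    moreover have "(of_real \<epsilon> :: complex) \<noteq> 0" using \<epsilon>(1) by simp
    ultimately show ?thesis by (simp only: floquet_scale_root k_def[symmetric] bloch_poly_def not_False_eq_True)
  qed
  \<comment> \<open>The root in the disc around the centre numbered 0, with the scaling
    undone.\<close>
  define l where "l x = \<rho> x 0 / of_real \<epsilon>" for x
  have el: "of_real \<epsilon> * l x = \<rho> x 0" for x using \<epsilon>(1) by (simp add: l_def)
  \<comment> \<open>Moving \<open>x\<close> by \<open>m\<close> multiplies \<open>u x $ j\<close> by
    \<open>zeta j (m $ j)\<close>, so the disc of \<open>l\<close> over \<open>kst + m\<close> is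
    the disc numbered \<open>m\<close> over \<open>kst\<close>.\<close>
  have shift: "centre c (u (\<chi> i. of_int (m $ i))) 0 = centre c (u 0) m" for m
    by (simp add: centre_def u_def zeta_def)
  have cu: "continuous_on UNIV (\<lambda>x. u x $ j)" for j
    unfolding u_def using q_pos[of j] by (auto intro!: continuous_intros)
  have nz: "of_real (c j) * u x $ j \<noteq> 0" for x j using c(1)[rule_format, of j] by (simp add: u_def)
  have "periodic_monic_family bloch_poly vol kst l"
  proof
    fix k m y
    show "poly (bloch_poly (k + (\<chi> i. of_int (m $ i)))) y = 0 \<longleftrightarrow> poly (bloch_poly k) y = 0" by (rule bloch_poly_periodic)
  next
    have "continuous_on UNIV (\<lambda>x. \<rho> x 0)"
    proof (rule continuous_on_unique_root[where p = P and a = "\<lambda>x. centre c (u x) 0" and r = r and Q = vol])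
      show "lead_coeff (P x) = 1" "degree (P x) = vol" for x unfolding P_def by (rule scaled_monic)+
      show "continuous_on UNIV (\<lambda>x. poly (P x) y)" for y
        unfolding P_def scaled_def
        by (rule continuous_on_poly_floquet) (use nz in \<open>auto intro!: continuous_intros cu\<close>)
      show "continuous_on UNIV (\<lambda>x. centre c (u x) 0)" unfolding centre_def by (intro continuous_intros cu)
    qed (use \<rho> root cell0 in auto)
    thus "continuous_on UNIV l" unfolding l_def using \<epsilon>(1) by (auto intro!: continuous_intros)
  next
    fix x :: "real^'n"
    show "poly (bloch_poly (kst + (\<chi> i. of_real (x $ i)))) (l x) = 0"
      unfolding scale[symmetric] el by (rule root[OF cell0])
    have "bij_betw (\<lambda>y. of_real \<epsilon> * y) {y. poly (bloch_poly (kst + (\<chi> i. of_real (x $ i)))) y = 0} {y. poly (P x) y = 0}"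
      unfolding scale[symmetric]
      by (rule bij_betw_byWitness[where f' = "\<lambda>y. y / of_real \<epsilon>"]) (use \<epsilon>(1) in auto)
    hence "card {y. poly (bloch_poly (kst + (\<chi> i. of_real (x $ i)))) y = 0} = card {y. poly (P x) y = 0}"
      by (rule bij_betw_same_card)
    also have "\<dots> = vol" unfolding \<rho>(4) card_image[OF \<rho>(3)] vol_def ..
    finally show "card {y. poly (bloch_poly (kst + (\<chi> i. of_real (x $ i)))) y = 0} = vol" .
  next
    fix y assume y: "poly (bloch_poly kst) y = 0"
    have z: "kst + (\<chi> i. of_real ((0 :: real^'n) $ i)) = kst" by (simp add: Finite_Cartesian_Product.vec_eq_iff)
    have "poly (P 0) (of_real \<epsilon> * y) = 0" using scale[of 0 y] y unfolding z by blast
    then obtain m where m: "m \<in> cell" "of_real \<epsilon> * y = \<rho> 0 m" using \<rho>(4)[of 0] by blast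
    define x :: "real^'n" where "x = (\<chi> i. of_int (m $ i))"
    have xm: "kst + (\<chi> i. of_real (x $ i)) = kst + (\<chi> i. of_int (m $ i))" by (simp add: x_def)
    \<comment> \<open>Carried back to \<open>kst\<close> by periodicity, this root lies in the disc
      numbered \<open>m\<close>, which holds only one root, namely \<epsilon> times \<open>y\<close>
      after scaling.\<close>
    have "poly (bloch_poly (kst + (\<chi> i. of_real (x $ i)))) (l x) = 0"
      unfolding scale[symmetric] el by (rule root[OF cell0])
    hence "poly (bloch_poly kst) (l x) = 0" unfolding xm bloch_poly_periodic .
    hence "poly (P 0) (\<rho> x 0) = 0" using scale[of 0 "l x"] unfolding z el by blast
    moreover have "dist (centre c (u 0) m) (\<rho> x 0) < r" using \<rho>(1)[OF cell0, of x] by (simp only: x_def shift)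
    ultimately have "\<rho> x 0 = \<rho> 0 m" by (rule \<rho>(2)[OF m(1)])
    hence "of_real \<epsilon> * l x = of_real \<epsilon> * y" using m(2) el by simp
    hence "y = l (\<chi> i. of_int (m $ i))" using \<epsilon>(1) by (simp add: x_def)
    thus "\<exists>m :: int^'n. y = l (\<chi> i. of_int (m $ i))" by blast
  qed
  thus ?thesis by blast
qed

end

theorem mainTheorem3:
  fixes q :: "int^'n" and V :: "int^'n \<Rightarrow> complex"
  assumes d2: "CARD('n) \<ge> 2"
    and qpos: "\<forall>j. q $ j > 0"
    and qgcd: "Gcd (range (\<lambda>j. q $ j)) = 1"
    and Vper: "\<forall>j n. V (n + axis j (q $ j)) = V n"
    and O1: "irreducible_component (bloch_variety q V) \<Omega>1"
    and O2: "irreducible_component (bloch_variety q V) \<Omega>2"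
  shows "\<exists>m :: int^'n. \<Omega>1 = (\<lambda>(k, lam). ((\<chi> i. k $ i + of_int (m $ i)), lam)) ` \<Omega>2"
proof -
  interpret periodic_potential q V using qpos Vper by unfold_locales auto
  obtain kst l where "periodic_monic_family bloch_poly vol kst l" using bloch_family by blast
  then interpret B: periodic_monic_family bloch_poly vol kst l .
  obtain m where "\<Omega>1 = (+) (int_shift m) ` \<Omega>2"
    using B.irreducible_components_translates[of \<Omega>1 \<Omega>2] O1 O2 unfolding bloch_variety_eq by blast
  moreover have "(+) (int_shift m) = (\<lambda>(k, lam). ((\<chi> i. k $ i + of_int (m $ i)), lam))"
    by (auto simp: fun_eq_iff int_shift_def Finite_Cartesian_Product.vec_eq_iff)
  ultimately show ?thesis by auto
qed

end
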